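(* For every $\varepsilon>0$ there exists $\zeta>0$ such that the following holds. Let $(p_n,q_n)_{n\ge0}$ and $(p'_n,q'_n)_{n\ge0}$ be sequences with $p_n,q_n,p'_n,q'_n\in[0,1]$ and $\sup_{n}\max\{|p_n-p'_n|,|q_n-q'_n|\}<\zeta$, and let $\mu,\mu'$ be the corresponding measures defined by the non-homogeneous Markov rule. Then $|\dim_*(\mu)-\dim_*(\mu')|<\varepsilon$ and $|\mathrm{Dim}_*(\mu)-\mathrm{Dim}_*(\mu')|<\varepsilon$. In other words, $|\dim_*(\mu)-\dim_*(\mu')|$ and $|\mathrm{Dim}_*(\mu)-\mathrm{Dim}_*(\mu')|$ tend to $0$ as $\|(p_n,q_n)_n-(p'_n,q'_n)_n\|_\infty\to0$.
   Context: $\mathbb K=\{0,1\}^{\mathbb N}$ with the metric in which the cylinder $I_{\epsilon_1\dots\epsilon_n}$ has diameter $2^{-n}$; $\mathcal F_n$ is the set of cylinders of generation $n$. Given $(p_n,q_n)_{n\ge0}$ with $0\le p_n,q_n\le 1$, the measure $\mu$ is the Borel probability measure on $\mathbb K$ with $\mu(I_0)=p_0$, $\mu(I_1)=1-p_0$ and, for $n\ge1$, $I=I_{\epsilon_1\dots\epsilon_n}$, $IJ=I_{\epsilon_1\dots\epsilon_n\epsilon_{n+1}}$: $\mu(IJ)/\mu(I)=p_n$ if $(\epsilon_n,\epsilon_{n+1})=(0,0)$, $1-p_n$ if $(0,1)$, $q_n$ if $(1,0)$, $1-q_n$ if $(1,1)$. $\dim_*(\mu)=\inf\{\dim_{\mathcal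 H}E: E\subset\mathbb K,\ \mu(E)>0\}$ and $\mathrm{Dim}_*(\mu)=\inf\{\dim_{\mathcal P}E: E\subset\mathbb K,\ \mu(E)>0\}$, with $\dim_{\mathcal H}$ the Hausdorff and $\dim_{\mathcal P}$ the packing dimension. *)

theory Defs
  imports "HOL-Probability.Probability"
begin

text \<open>Points of K are maps nat => bool; x 0 is the first symbol epsilon_1, and
  False encodes the digit 0, True the digit 1.\<close>

definition cdist :: "(nat \<Rightarrow> bool) \<Rightarrow> (nat \<Rightarrow> bool) \<Rightarrow> real" where
  "cdist x y = (if x = y then 0 else (1/2) ^ (LEAST i. x i \<noteq> y i))"

definition cdiam :: "(nat \<Rightarrow> bool) set \<Rightarrow> real" where
  "cdiam E = (if E = {} then 0 else (SUP xy\<in>E \<times> E. cdist (fst xy) (snd xy)))"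

definition ccball :: "(nat \<Rightarrow> bool) \<Rightarrow> real \<Rightarrow> (nat \<Rightarrow> bool) set" where
  "ccball x r = {y. cdist x y \<le> r}"

definition copen :: "(nat \<Rightarrow> bool) set \<Rightarrow> bool" where
  "copen U \<longleftrightarrow> (\<forall>x\<in>U. \<exists>r>0. {y. cdist x y < r} \<subseteq> U)"

definition cantor_borel :: "(nat \<Rightarrow> bool) measure" where
  "cantor_borel = sigma UNIV {U. copen U}"

definition cyl :: "bool list \<Rightarrow> (nat \<Rightarrow> bool) set" where
  "cyl w = {x. \<forall>i<length w. x i = w ! i}"

definition hcontent :: "real \<Rightarrow> real \<Rightarrow> (nat \<Rightarrow> bool) set \<Rightarrow> ennreal" where
  "hcontent \<delta> s E =
     (INF U\<in>{U :: nat \<Rightarrow> (nat \<Rightarrow> bool) set. E \<subseteq> (\<Union>i. U i) \<and> (\<forall>i. cdiam (U i) \<le> \<delta>)}.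
        (\<Sum>i. ennreal (cdiam (U i) powr s)))"

definition hmeasure :: "real \<Rightarrow> (nat \<Rightarrow> bool) set \<Rightarrow> ennreal" where
  "hmeasure s E = (SUP \<delta>\<in>{0<..}. hcontent \<delta> s E)"

definition hdim :: "(nat \<Rightarrow> bool) set \<Rightarrow> real" where
  "hdim E = Inf {s. 0 \<le> s \<and> hmeasure s E = 0}"

definition packings :: "real \<Rightarrow> (nat \<Rightarrow> bool) set \<Rightarrow> ((nat \<Rightarrow> bool) \<times> real) set set" where
  "packings \<delta> E = {P. finite P \<and> (\<forall>(x,r)\<in>P. x \<in> E \<and> 0 < r \<and> r \<le> \<delta>) \<and>
      (\<forall>a\<in>P. \<forall>b\<in>P. a \<noteq> b \<longrightarrow> ccball (fst a) (snd a) \<inter> ccball (fst b) (snd b) = {})}"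

definition ppre_delta :: "real \<Rightarrow> real \<Rightarrow> (nat \<Rightarrow> bool) set \<Rightarrow> ennreal" where
  "ppre_delta \<delta> s E = (SUP P\<in>packings \<delta> E. (\<Sum>(x,r)\<in>P. ennreal ((2 * r) powr s)))"

definition ppremeasure :: "real \<Rightarrow> (nat \<Rightarrow> bool) set \<Rightarrow> ennreal" where
  "ppremeasure s E = (INF \<delta>\<in>{0<..}. ppre_delta \<delta> s E)"

definition pmeasure :: "real \<Rightarrow> (nat \<Rightarrow> bool) set \<Rightarrow> ennreal" where
  "pmeasure s E = (INF F\<in>{F :: nat \<Rightarrow> (nat \<Rightarrow> bool) set. E \<subseteq> (\<Union>i. F i)}.
                      (\<Sum>i. ppremeasure s (F i)))"

definition pdim :: "(nat \<Rightarrow> bool) set \<Rightarrow> real" where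
  "pdim E = Inf {s. 0 \<le> s \<and> pmeasure s E = 0}"

definition trans_prob :: "(nat \<Rightarrow> real) \<Rightarrow> (nat \<Rightarrow> real) \<Rightarrow> nat \<Rightarrow> bool \<Rightarrow> bool \<Rightarrow> real" where
  "trans_prob p q n a b =
     (if \<not> a \<and> \<not> b then p n else if \<not> a \<and> b then 1 - p n
      else if a \<and> \<not> b then q n else 1 - q n)"

text \<open>mu(I_{eps_1...eps_n}) = mu(I_{eps_1}) * prod_{k=1}^{n-1} (transition at generation k
  from eps_k to eps_{k+1}); with w ! (k-1) = eps_k.\<close>
definition markov_cyl :: "(nat \<Rightarrow> real) \<Rightarrow> (nat \<Rightarrow> real) \<Rightarrow> bool list \<Rightarrow> real" where
  "markov_cyl p q w =
     (case w of [] \<Rightarrow> 1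
      | e # _ \<Rightarrow> (if e then 1 - p 0 else p 0) *
                 (\<Prod>k\<in>{1..<length w}. trans_prob p q k (w ! (k - 1)) (w ! k)))"

definition markov_measure :: "(nat \<Rightarrow> real) \<Rightarrow> (nat \<Rightarrow> real) \<Rightarrow> (nat \<Rightarrow> bool) measure \<Rightarrow> bool" where
  "markov_measure p q M \<longleftrightarrow> prob_space M \<and> sets M = sets cantor_borel \<and>
      (\<forall>w. measure M (cyl w) = markov_cyl p q w)"

definition lower_hdim :: "(nat \<Rightarrow> bool) measure \<Rightarrow> real" where
  "lower_hdim M = Inf {hdim E | E. E \<in> sets M \<and> measure M E > 0}"

definition lower_pdim :: "(nat \<Rightarrow> bool) measure \<Rightarrow> real" where
  "lower_pdim M = Inf {pdim E | E. E \<in> sets M \<and> measure M E > 0}"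

end

theory Submission
  imports Defs "HOL-Real_Asymp.Real_Asymp" "HOL-Library.Discrete_Functions"
begin

text \<open>For almost every \<open>x\<close>, \<open>- ln \<mu>(I\<^sub>n(x)) - H\<^sub>n\<close> is \<open>o(n)\<close>, where \<open>H\<^sub>n\<close> is the mean information of the
  first \<open>n\<close> symbols. Hence the two dimensions are the lower and upper limits of \<open>H\<^sub>n / (n ln 2)\<close>, and it
  remains to see that \<open>H\<^sub>n / n\<close> depends on the parameters continuously, uniformly in \<open>n\<close>.

  Both points rest on one observation. Step \<open>k\<close> contracts the dependence on the past by the factor
  \<open>\<bar>p\<^sub>k - q\<^sub>k\<bar>\<close>. There is no uniform mixing, but where the factor is close to \<open>1\<close> the step is nearly
  deterministic: for each \<open>\<eta> > 0\<close> there is \<open>B\<close> such that the entropies of step \<open>k\<close> are at most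
  \<open>B (1 - \<bar>p\<^sub>k - q\<^sub>k\<bar>) + \<eta>\<close>. After clipping the entropies at \<open>B (1 - \<bar>p\<^sub>k - q\<^sub>k\<bar>)\<close>, the expected
  future entropy varies by at most \<open>B\<close> with the present state, whatever the horizon. This makes the
  variance of the information linear in \<open>n\<close> (Chebyshev and Borel--Cantelli along the squares then
  give the almost sure statement), and it makes the effect of perturbing one step by \<open>\<zeta>\<close> at most
  of order \<open>B \<zeta>\<close>.\<close>

section \<open>Binary entropy and inhomogeneous two-state chains\<close>

definition binary_entropy :: "real \<Rightarrow> real" where
  "binary_entropy x = - (x * ln x) - (1 - x) * ln (1 - x)"

lemma binary_entropy_symmetric: "binary_entropy (1 - x) = binary_entropy x"
  by (simp add: binary_entropy_def)

lemma neg_x_ln_x_bounds: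
  fixes x :: real
  assumes "0 \<le> x" "x \<le> 1"
  shows "0 \<le> - (x * ln x)" "- (x * ln x) \<le> 1 - x"
proof -
  show "0 \<le> - (x * ln x)"
    using assms by (cases "x = 0") (auto simp: mult_le_0_iff)
  show "- (x * ln x) \<le> 1 - x"
  proof (cases "x = 0")
    case False
    then have "ln (1 / x) \<le> 1 / x - 1"
      using assms by (intro ln_le_minus_one) auto
    then have "x * - ln x \<le> x * (1 / x - 1)"
      using assms False by (intro mult_left_mono) (auto simp: ln_div)
    also have "\<dots> = 1 - x"
      using False by (simp add: right_diff_distrib)
    finally show ?thesis
      by simp
  qed simp
qed

lemma binary_entropy_bounds:
  assumes "0 \<le> x" "x \<le> 1"
  shows "0 \<le> binary_entropy x" "binary_entropy x \<le> 1"
  using neg_x_ln_x_bounds[of x] neg_x_ln_x_bounds[of "1 - x"] assms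
  by (auto simp: binary_entropy_def)

text \<open>With \<open>x = r\<^sup>2\<close> the left side becomes
  \<open>4 * (r * ln r)\<^sup>2\<close>. This controls the second moment of the information of a
  single symbol, however small its probability.\<close>

lemma x_ln_x_squared_le:
  fixes x :: real
  assumes "0 \<le> x" "x \<le> 1"
  shows "x * (ln x)\<^sup>2 \<le> 4"
proof (cases "x = 0")
  case False
  define r where "r = sqrt x"
  have r: "0 < r" "r \<le> 1" "x = r\<^sup>2"
    using assms False by (auto simp: r_def)
  have "0 \<le> - (r * ln r)" "- (r * ln r) \<le> 1"
    using neg_x_ln_x_bounds[of r] r by auto
  then have "(r * ln r)\<^sup>2 \<le> 1"
    by (smt (verit) power2_minus power_le_one)
  moreover have "ln x = 2 * ln r"
    using r by (simp add: ln_realpow)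
  ultimately show ?thesis
    using r(3) by (simp add: power_mult_distrib)
qed simp

lemma continuous_on_binary_entropy: "continuous_on {0..1} binary_entropy"
proof -
  have *: "continuous_on {0..1} (\<lambda>x::real. x * ln x)"
    unfolding continuous_on_eq_continuous_within
  proof
    fix x :: real
    assume x: "x \<in> {0..1}"
    show "continuous (at x within {0..1}) (\<lambda>x. x * ln x)"
    proof (cases "x = 0")
      case True
      have "((\<lambda>x::real. x * ln x) \<longlongrightarrow> 0) (at_right 0)"
        by real_asymp
      then have "((\<lambda>x::real. x * ln x) \<longlongrightarrow> 0) (at 0 within {0..1})"
        by (simp add: at_within_Icc_at_right)
      then show ?thesis
        by (simp add: continuous_within True)
    next
      case False
      then show ?thesis
        using x by (intro continuous_intros) auto
    qed
  qed
  have "continuous_on {0..1} (\<lambda>x::real. (1 - x) * ln (1 - x))"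
    by (rule continuous_on_compose2[OF *, of _ "\<lambda>x. 1 - x"]) (auto intro!: continuous_intros)
  with * show ?thesis
    unfolding binary_entropy_def[abs_def] by (intro continuous_on_diff continuous_on_minus)
qed

lemma binary_entropy_uniform_modulus:
  assumes "\<eta> > 0"
  obtains \<delta> where "\<delta> > 0"
    and "\<And>x y. x \<in> {0..1} \<Longrightarrow> y \<in> {0..1} \<Longrightarrow> \<bar>x - y\<bar> < \<delta> \<Longrightarrow>
      \<bar>binary_entropy x - binary_entropy y\<bar> \<le> \<eta>"
proof -
  have "uniformly_continuous_on {0..1} binary_entropy"
    by (intro compact_uniformly_continuous continuous_on_binary_entropy compact_Icc)
  then obtain \<delta> where "\<delta> > 0"
    "\<forall>x\<in>{0..1}. \<forall>y\<in>{0..1}. dist y x < \<delta> \<longrightarrow> dist (binary_entropy y) (binary_entropy x) < \<eta>"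
    using assms unfolding uniformly_continuous_on_def by blast
  then show ?thesis
    by (intro that[of \<delta>]) (auto simp: dist_real_def abs_minus_commute less_imp_le)
qed

text \<open>The slope of the entropy is infinite at the endpoints, hence the additive
  \<open>\<eta>\<close>. Within \<open>\<delta>\<close> of an endpoint continuity gives at most
  \<open>\<eta>\<close>; farther away a line of slope \<open>1 / \<delta>\<close> is already above
  the bound 1.\<close>

lemma binary_entropy_le_linear:
  assumes "\<eta> > 0"
  obtains B where "B \<ge> 0"
    and "\<And>x. x \<in> {0..1} \<Longrightarrow> binary_entropy x \<le> B * min x (1 - x) + \<eta>"
proof -
  obtain \<delta> where \<delta>: "\<delta> > 0"
    "\<And>x y. x \<in> {0..1} \<Longrightarrow> y \<in> {0..1} \<Longrightarrow> \<bar>x - y\<bar> < \<delta> \<Longrightarrow>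
      \<bar>binary_entropy x - binary_entropy y\<bar> \<le> \<eta>"
    using binary_entropy_uniform_modulus[OF assms] by blast
  have *: "binary_entropy x \<le> 1 / \<delta> * x + \<eta>" if x: "x \<in> {0..1}" for x
  proof (cases "x < \<delta>")
    case True
    then have "binary_entropy x \<le> \<eta>"
      using \<delta>(2)[of x 0] x binary_entropy_bounds(1)[of x] by (simp add: binary_entropy_def)
    moreover have "0 \<le> 1 / \<delta> * x"
      using x \<delta> by auto
    ultimately show ?thesis
      by linarith
  next
    case False
    then have "1 \<le> 1 / \<delta> * x"
      using \<delta>(1) by (simp add: field_simps)
    then show ?thesis
      using binary_entropy_bounds(2)[of x] x assms by simp
  qed
  show ?thesis
  proof (rule that[of "1 / \<delta>"])
    show "0 \<le> 1 / \<delta>"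
      using \<delta> by simp
    show "binary_entropy x \<le> 1 / \<delta> * min x (1 - x) + \<eta>" if "x \<in> {0..1}" for x
      using *[of x] *[of "1 - x"] that by (auto simp: binary_entropy_symmetric min_def)
  qed
qed

section \<open>Words and path sums of a two-state chain\<close>

definition words :: "nat \<Rightarrow> bool list set" where
  "words n = {w. length w = n}"

lemma finite_words [simp]: "finite (words n)"
  using finite_lists_length_eq[of "UNIV :: bool set" n] by (simp add: words_def)

lemma words_0 [simp]: "words 0 = {[]}"
  by (auto simp: words_def)

lemma sum_words_Suc:
  "(\<Sum>w\<in>words (Suc n). f w) = (\<Sum>w\<in>words n. f (False # w)) + (\<Sum>w\<in>words n. f (True # w))"
  for f :: "bool list \<Rightarrow> 'a::comm_monoid_add"
proof -
  have *: "words (Suc n) = (#) False ` words n \<union> (#) True ` words n"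
    by (auto simp: words_def length_Suc_conv image_iff)
  show ?thesis
    unfolding * by (subst sum.union_disjoint) (auto simp: sum.reindex)
qed

locale transition_kernel =
  fixes t :: "nat \<Rightarrow> bool \<Rightarrow> bool \<Rightarrow> real"
  assumes t_nonneg: "0 \<le> t k a b"
    and t_total: "t k a False + t k a True = 1"
begin

fun path_weight :: "nat \<Rightarrow> bool \<Rightarrow> bool list \<Rightarrow> real" where
  "path_weight k a [] = 1"
| "path_weight k a (b # w) = t k a b * path_weight (Suc k) b w"

fun path_cost :: "(nat \<Rightarrow> bool \<Rightarrow> bool \<Rightarrow> real) \<Rightarrow> nat \<Rightarrow> bool \<Rightarrow> bool list \<Rightarrow> real" where
  "path_cost c k a [] = 0"
| "path_cost c k a (b # w) = c k a b + path_cost c (Suc k) b w"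

text \<open>The expectation of \<open>f k X\<^sub>k + \<dots> + f (k + m - 1) X\<^bsub>k + m - 1\<^esub>\<close> for the chain started at time
  \<open>k\<close> in the state \<open>a\<close>.\<close>
fun mean_sum :: "(nat \<Rightarrow> bool \<Rightarrow> real) \<Rightarrow> nat \<Rightarrow> nat \<Rightarrow> bool \<Rightarrow> real" where
  "mean_sum f 0 k a = 0"
| "mean_sum f (Suc m) k a =
    f k a + t k a False * mean_sum f m (Suc k) False + t k a True * mean_sum f m (Suc k) True"

definition step_entropy :: "nat \<Rightarrow> bool \<Rightarrow> real" where
  "step_entropy k a = binary_entropy (t k a False)"

text \<open>The absolute value is the modulus of the second eigenvalue of the stochastic matrix of
  step \<open>k\<close>, which is also its Dobrushin contraction coefficient.\<close>

definition mixing :: "nat \<Rightarrow> real" where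
  "mixing k = 1 - \<bar>t k False False - t k True False\<bar>"

text \<open>A step that hardly mixes is nearly deterministic, so clipping the entropy at a large
  multiple of the mixing rate changes it by little only.\<close>
definition clipped_entropy :: "real \<Rightarrow> nat \<Rightarrow> bool \<Rightarrow> real" where
  "clipped_entropy B k a = min (step_entropy k a) (B * mixing k)"

lemma t_True: "t k a True = 1 - t k a False"
  using t_total[of k a] by simp

lemma t_le_1: "t k a b \<le> 1"
  using t_nonneg[of k a "\<not> b"] t_total[of k a] by (cases b) auto

lemma t_range: "t k a b \<in> {0..1}"
  using t_nonneg t_le_1 by simp

lemma mixing_nonneg: "0 \<le> mixing k"
  using t_range[of k False False] t_range[of k True False] by (auto simp: mixing_def)

lemma step_entropy_bounds: "0 \<le> step_entropy k a" "step_entropy k a \<le> 1"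
  unfolding step_entropy_def using binary_entropy_bounds t_nonneg t_le_1 by auto

text \<open>For \<open>x\<close>, \<open>y\<close> in \<open>{0..1}\<close> the distance of
  \<open>x\<close> and \<open>y\<close> is at most \<open>max x (1 - x)\<close>. Hence
  \<open>min x (1 - x)\<close> is at most \<open>mixing k\<close> for either row of step
  \<open>k\<close>, and the linear bound on the entropy becomes a bound in terms of
  \<open>mixing\<close>.\<close>

lemma clipped_entropy_bounds:
  assumes "B \<ge> 0" and "\<And>x. x \<in> {0..1} \<Longrightarrow> binary_entropy x \<le> B * min x (1 - x) + \<eta>"
  shows "0 \<le> clipped_entropy B k a" "clipped_entropy B k a \<le> step_entropy k a"
    "clipped_entropy B k a \<le> B * mixing k" "step_entropy k a \<le> clipped_entropy B k a + \<eta>"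
proof -
  have eta: "0 \<le> \<eta>"
    using assms(2)[of 0] by (simp add: binary_entropy_def)
  let ?x = "t k a False"
  have "min ?x (1 - ?x) \<le> mixing k"
    using t_range[of k False False] t_range[of k True False]
    by (cases a) (auto simp: mixing_def min_def)
  then have "B * min ?x (1 - ?x) \<le> B * mixing k"
    using assms(1) by (rule mult_left_mono)
  then have "step_entropy k a \<le> B * mixing k + \<eta>"
    using assms(2)[OF t_range, of k a False] by (simp add: step_entropy_def)
  then show "step_entropy k a \<le> clipped_entropy B k a + \<eta>"
    using eta by (simp add: clipped_entropy_def)
  show "0 \<le> clipped_entropy B k a" "clipped_entropy B k a \<le> step_entropy k a"
    "clipped_entropy B k a \<le> B * mixing k"
    using step_entropy_bounds mixing_nonneg assms(1) by (auto simp: clipped_entropy_def)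
qed

lemma path_weight_nonneg: "0 \<le> path_weight k a w"
  by (induction w arbitrary: k a) (auto simp: t_nonneg)

lemma sum_path_weight: "(\<Sum>w\<in>words m. path_weight k a w) = 1"
  by (induction m arbitrary: k a) (auto simp: sum_words_Suc sum_distrib_left[symmetric] t_total)

text \<open>Positivity of the product keeps every factor away from 0, where \<open>ln\<close> is not
  additive.\<close>

lemma path_cost_ln_eq:
  "path_weight k a w > 0 \<Longrightarrow> path_cost (\<lambda>k a b. - ln (t k a b)) k a w = - ln (path_weight k a w)"
proof (induction w arbitrary: k a)
  case (Cons b w)
  have "t k a b > 0" "path_weight (Suc k) b w > 0"
    using Cons.prems t_nonneg[of k a b] path_weight_nonneg[of "Suc k" b w]
    by (auto simp: zero_less_mult_iff)
  then show ?case
    using Cons.IH by (simp add: ln_mult)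
qed simp

lemma mean_sum_mono:
  assumes "\<And>k a. f k a \<le> g k a + \<eta>"
  shows "mean_sum f m k a \<le> mean_sum g m k a + \<eta> * m"
proof (induction m arbitrary: k a)
  case (Suc m)
  have "t k a b * mean_sum f m (Suc k) b \<le> t k a b * (mean_sum g m (Suc k) b + \<eta> * m)" for b
    using Suc t_nonneg by (intro mult_left_mono) auto
  from this[of True] this[of False] show ?case
    using assms[of k a] by (simp add: t_True algebra_simps)
qed simp

text \<open>The additional step sits at the end of the horizon while \<open>mean_sum\<close> unfolds
  at its beginning, so the induction carries the inequalities through the average over the first
  transition.\<close>

lemma mean_sum_Suc_bounds:
  assumes "\<And>k a. 0 \<le> f k a" "\<And>k a. f k a \<le> 1"
  shows "mean_sum f m k a \<le> mean_sum f (Suc m) k a \<and> mean_sum f (Suc m) k a \<le> mean_sum f m k a + 1"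
proof (induction m arbitrary: k a)
  case (Suc m)
  have "t k a b * mean_sum f m (Suc k) b \<le> t k a b * mean_sum f (Suc m) (Suc k) b"
    "t k a b * mean_sum f (Suc m) (Suc k) b \<le> t k a b * (mean_sum f m (Suc k) b + 1)" for b
    using Suc t_nonneg by (intro mult_left_mono; blast)+
  from this[of True] this[of False] show ?case
    by (subst (2 3) mean_sum.simps(2), subst (1 4) mean_sum.simps(2))
      (simp add: t_True algebra_simps del: mean_sum.simps)
qed (auto simp: assms)

text \<open>The contraction factor of step \<open>k\<close> is \<open>1 - mixing k\<close>, which leaves room for an oscillation
  \<open>B * mixing k\<close> of \<open>f k\<close>.\<close>
lemma mean_sum_oscillation:
  assumes "B \<ge> 0" "\<And>k a. 0 \<le> f k a" "\<And>k a. f k a \<le> B * mixing k"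
  shows "\<bar>mean_sum f m k False - mean_sum f m k True\<bar> \<le> B"
proof (induction m arbitrary: k)
  case (Suc m)
  let ?d = "mean_sum f m (Suc k) False - mean_sum f m (Suc k) True"
  let ?c = "t k False False - t k True False"
  have "mean_sum f (Suc m) k False - mean_sum f (Suc m) k True = (f k False - f k True) + ?c * ?d"
    by (simp add: t_True algebra_simps)
  moreover have "\<bar>?c * ?d\<bar> \<le> (1 - mixing k) * B"
    using Suc[of "Suc k"] assms(1) by (auto simp: mixing_def abs_mult intro!: mult_mono)
  moreover have "\<bar>f k False - f k True\<bar> \<le> B * mixing k"
    using assms(2,3)[of k False] assms(2,3)[of k True] by linarith
  ultimately show ?case
    by (simp add: algebra_simps)
qed (use assms in auto)

text \<open>Tower property: \<open>f\<close> is the conditional mean of the step cost, and the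
  remainder is averaged given the first symbol.\<close>

lemma mean_path_cost:
  assumes "\<And>k a. t k a False * c k a False + t k a True * c k a True = f k a"
  shows "(\<Sum>w\<in>words m. path_weight k a w * path_cost c k a w) = mean_sum f m k a"
proof (induction m arbitrary: k a)
  case (Suc m)
  have "(\<Sum>w\<in>words m. path_weight k a (b # w) * path_cost c k a (b # w)) =
      t k a b * (c k a b + mean_sum f m (Suc k) b)" for b
  proof -
    have "(\<Sum>w\<in>words m. path_weight k a (b # w) * path_cost c k a (b # w)) =
      t k a b * (c k a b * (\<Sum>w\<in>words m. path_weight (Suc k) b w) +
        (\<Sum>w\<in>words m. path_weight (Suc k) b w * path_cost c (Suc k) b w))"
      by (simp add: sum_distrib_left sum.distrib[symmetric] algebra_simps)
    then show ?thesis
      by (simp add: Suc sum_path_weight)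
  qed
  then show ?case
    using assms[of k a] by (simp only: sum_words_Suc) (simp add: algebra_simps)
qed simp

text \<open>Martingale decomposition. Given the first symbol \<open>b\<close>, the deviation is the
  deviation of the remaining path plus the increment \<open>D b\<close>. The former has conditional
  mean 0, so the variances of the steps add up, and \<open>K\<close> bounds each of them.\<close>

lemma variance_path_cost:
  assumes mean: "\<And>k a. t k a False * c k a False + t k a True * c k a True = f k a"
    and step: "\<And>m k a. (\<Sum>b\<in>UNIV. t k a b *
      (c k a b + mean_sum f m (Suc k) b - mean_sum f (Suc m) k a)\<^sup>2) \<le> K"
  shows "(\<Sum>w\<in>words m. path_weight k a w * (path_cost c k a w - mean_sum f m k a)\<^sup>2) \<le> m * K"
proof (induction m arbitrary: k a)
  case (Suc m)
  define D where "D b = c k a b + mean_sum f m (Suc k) b - mean_sum f (Suc m) k a" for b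
  have *: "(\<Sum>w\<in>words m. path_weight k a (b # w) *
      (path_cost c k a (b # w) - mean_sum f (Suc m) k a)\<^sup>2) \<le> t k a b * (m * K) + t k a b * (D b)\<^sup>2" for b
  proof -
    let ?W = "\<lambda>w. path_weight (Suc k) b w" and ?M = "mean_sum f m (Suc k) b"
    let ?C = "\<lambda>w. path_cost c (Suc k) b w"
    have "(\<Sum>w\<in>words m. path_weight k a (b # w) *
        (path_cost c k a (b # w) - mean_sum f (Suc m) k a)\<^sup>2)
      = (\<Sum>w\<in>words m. t k a b * (?W w * (?C w - ?M)\<^sup>2 + 2 * D b * (?W w * ?C w - ?M * ?W w)
          + (D b)\<^sup>2 * ?W w))"
      by (intro sum.cong refl) (simp add: D_def power2_eq_square algebra_simps del: mean_sum.simps)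
    also have "\<dots> = t k a b * ((\<Sum>w\<in>words m. ?W w * (?C w - ?M)\<^sup>2) +
        2 * D b * ((\<Sum>w\<in>words m. ?W w * ?C w) - ?M * (\<Sum>w\<in>words m. ?W w))
        + (D b)\<^sup>2 * (\<Sum>w\<in>words m. ?W w))"
      by (simp only: sum_distrib_left[symmetric] sum.distrib sum_subtractf)
    \<comment> \<open>The cross term vanishes because \<open>?M\<close> is the mean of
      \<open>?C\<close>.\<close>
    also have "\<dots> = t k a b * ((\<Sum>w\<in>words m. ?W w * (?C w - ?M)\<^sup>2) + (D b)\<^sup>2)"
      by (simp add: mean_path_cost[OF mean] sum_path_weight)
    also have "\<dots> \<le> t k a b * (m * K + (D b)\<^sup>2)"
      using Suc t_nonneg by (intro mult_left_mono add_right_mono) auto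
    finally show ?thesis
      by (simp add: algebra_simps)
  qed
  have "t k a False * (D False)\<^sup>2 + t k a True * (D True)\<^sup>2 \<le> K"
    using step[of k a m] by (simp add: D_def UNIV_bool del: mean_sum.simps)
  moreover have "t k a False * (m * K) + t k a True * (m * K) = m * K"
    by (simp add: distrib_right[symmetric] t_total)
  ultimately show ?case
    using *[of False] *[of True] by (simp only: sum_words_Suc) (simp add: algebra_simps del: mean_sum.simps)
qed simp

text \<open>The mean minimises the mean square deviation, so a more convenient centre
  \<open>z\<close> may replace it when only an upper bound is wanted.\<close>

lemma variance_le_second_moment:
  fixes y :: "bool \<Rightarrow> real"
  assumes "\<mu> = t k a False * y False + t k a True * y True"
  shows "(\<Sum>b\<in>UNIV. t k a b * (y b - \<mu>)\<^sup>2) \<le> (\<Sum>b\<in>UNIV. t k a b * (y b - z)\<^sup>2)"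
proof -
  have "(\<Sum>b\<in>UNIV. t k a b * (y b - z)\<^sup>2) - (\<Sum>b\<in>UNIV. t k a b * (y b - \<mu>)\<^sup>2) = (\<mu> - z)\<^sup>2"
    by (simp add: UNIV_bool assms t_True power2_eq_square algebra_simps)
  then show ?thesis
    by (smt (verit) zero_le_power2)
qed

text \<open>The cost of a step is its information content, shifted so that its conditional mean is the
  clipped entropy.\<close>
lemma variance_information:
  fixes B :: real
  defines "c \<equiv> \<lambda>k a b. - ln (t k a b) - (step_entropy k a - clipped_entropy B k a)"
  assumes B: "B \<ge> 0"
  shows "(\<Sum>w\<in>words m. path_weight k a w *
      (path_cost c k a w - mean_sum (clipped_entropy B) m k a)\<^sup>2) \<le> m * (12 + 2 * B\<^sup>2)"
proof (rule variance_path_cost)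
  show mean: "t k a False * c k a False + t k a True * c k a True = clipped_entropy B k a" for k a
    by (simp add: c_def step_entropy_def binary_entropy_def t_True algebra_simps)
  fix m k a
  define g where "g b = mean_sum (clipped_entropy B) m (Suc k) b" for b
  \<comment> \<open>This centre cancels the shift of the cost and the future value
    \<open>g False\<close>. What remains is \<open>- ln (t k a False)\<close> for the symbol
    \<open>False\<close>, and for \<open>True\<close> the information plus
    \<open>g True - g False\<close>, which is at most \<open>B\<close> in modulus.\<close>
  define z where "z = g False - (step_entropy k a - clipped_entropy B k a)"
  have osc: "\<bar>g False - g True\<bar> \<le> B"
    unfolding g_def using B step_entropy_bounds(1) mixing_nonneg
    by (intro mean_sum_oscillation) (auto simp: clipped_entropy_def)
  let ?l = "ln (t k a True)"
  have "(\<Sum>b\<in>UNIV. t k a b * (c k a b + g b - mean_sum (clipped_entropy B) (Suc m) k a)\<^sup>2)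
      \<le> (\<Sum>b\<in>UNIV. t k a b * (c k a b + g b - z)\<^sup>2)"
    using mean[of k a] by (intro variance_le_second_moment) (simp add: g_def algebra_simps)
  also have "\<dots> = t k a False * (ln (t k a False))\<^sup>2 + t k a True * ((g True - g False) - ?l)\<^sup>2"
    by (simp add: UNIV_bool z_def c_def)
  \<comment> \<open>Doubling the squares separates the oscillation from the information. The
    constant 12 is 4 from the symbol \<open>False\<close> plus twice 4 from the symbol
    \<open>True\<close>.\<close>
  also have "((g True - g False) - ?l)\<^sup>2 \<le> 2 * (g True - g False)\<^sup>2 + 2 * ?l\<^sup>2"
    using zero_le_power2[of "(g True - g False) + ?l"] by (simp add: power2_eq_square algebra_simps)
  also have "(g True - g False)\<^sup>2 \<le> B\<^sup>2"
    using osc B by (simp add: abs_le_square_iff[symmetric])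
  also have "t k a True * (2 * B\<^sup>2 + 2 * ?l\<^sup>2) \<le> 2 * B\<^sup>2 + 8"
  proof -
    have "t k a True * B\<^sup>2 \<le> B\<^sup>2"
      using t_nonneg t_le_1 by (simp add: mult_left_le_one_le)
    moreover have "t k a True * ?l\<^sup>2 \<le> 4"
      by (intro x_ln_x_squared_le t_nonneg t_le_1)
    ultimately show ?thesis
      by (simp add: algebra_simps)
  qed
  also have "t k a False * (ln (t k a False))\<^sup>2 \<le> 4"
    by (intro x_ln_x_squared_le t_nonneg t_le_1)
  finally show "(\<Sum>b\<in>UNIV. t k a b * (c k a b + mean_sum (clipped_entropy B) m (Suc k) b -
      mean_sum (clipped_entropy B) (Suc m) k a)\<^sup>2) \<le> 12 + 2 * B\<^sup>2"
    using t_nonneg by (simp add: g_def mult_left_mono)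
qed

end

text \<open>Changing the first step has two effects. The clipped entropy moves by at most
  \<open>\<eta> + 2 * B * \<zeta>\<close>, as \<open>mixing\<close> moves by at most
  \<open>2 * \<zeta>\<close>; the transition moves mass at most \<open>\<zeta>\<close> between
  futures that differ by at most \<open>B\<close>. The remaining difference is an average of the
  induction hypothesis, so errors add up linearly in \<open>m\<close>.\<close>

lemma mean_clipped_entropy_diff:
  assumes t: "transition_kernel t" and t': "transition_kernel t'"
    and B: "B \<ge> 0"
    and close: "\<And>k a. \<bar>t k a False - t' k a False\<bar> \<le> \<zeta>"
    and ent: "\<And>k a. \<bar>binary_entropy (t k a False) - binary_entropy (t' k a False)\<bar> \<le> \<eta>"
  shows "\<bar>transition_kernel.mean_sum t (transition_kernel.clipped_entropy t B) m k a -
      transition_kernel.mean_sum t' (transition_kernel.clipped_entropy t' B) m k a\<bar>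
    \<le> (\<eta> + 3 * B * \<zeta>) * m"
proof -
  interpret A: transition_kernel t by fact
  interpret A': transition_kernel t' by fact
  let ?f = "A.clipped_entropy B" and ?f' = "A'.clipped_entropy B"
  show ?thesis
  proof (induction m arbitrary: k a)
    case (Suc m)
    let ?x = "A.mean_sum ?f m (Suc k)" and ?x' = "A'.mean_sum ?f' m (Suc k)"
    have "\<bar>A.mixing k - A'.mixing k\<bar> \<le> 2 * \<zeta>"
      unfolding A.mixing_def A'.mixing_def using close[of k False] close[of k True] by linarith
    then have "\<bar>B * A.mixing k - B * A'.mixing k\<bar> \<le> B * (2 * \<zeta>)"
      using B by (simp add: right_diff_distrib[symmetric] abs_mult mult_left_mono)
    moreover have "\<bar>A.step_entropy k a - A'.step_entropy k a\<bar> \<le> \<eta>"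
      using ent by (simp add: A.step_entropy_def A'.step_entropy_def)
    ultimately have 1: "\<bar>?f k a - ?f' k a\<bar> \<le> \<eta> + 2 * B * \<zeta>"
      unfolding A.clipped_entropy_def A'.clipped_entropy_def by (auto simp: min_def)
    have "\<bar>?x' False - ?x' True\<bar> \<le> B"
      using B A'.step_entropy_bounds(1) A'.mixing_nonneg
      by (intro A'.mean_sum_oscillation) (auto simp: A'.clipped_entropy_def)
    then have 2: "\<bar>(t k a False - t' k a False) * (?x' False - ?x' True)\<bar> \<le> \<zeta> * B"
      using close[of k a] by (auto simp: abs_mult intro!: mult_mono)
    have "\<bar>t k a b * (?x b - ?x' b)\<bar> \<le> t k a b * ((\<eta> + 3 * B * \<zeta>) * m)" for b
      using Suc[of "Suc k" b] A.t_nonneg[of k a b] by (simp add: abs_mult mult_left_mono)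
    from this[of True] this[of False]
    have 3: "\<bar>t k a False * (?x False - ?x' False) + t k a True * (?x True - ?x' True)\<bar> \<le>
        (\<eta> + 3 * B * \<zeta>) * m"
      by (simp add: A.t_True left_diff_distrib)
    have "A.mean_sum ?f (Suc m) k a - A'.mean_sum ?f' (Suc m) k a = (?f k a - ?f' k a) +
        (t k a False - t' k a False) * (?x' False - ?x' True) +
        (t k a False * (?x False - ?x' False) + t k a True * (?x True - ?x' True))"
      by (simp add: A.t_True A'.t_True algebra_simps)
    with 1 2 3 show ?case
      by (simp add: algebra_simps)
  qed simp
qed

section \<open>Almost sure behaviour of cylinder masses\<close>

definition pref :: "(nat \<Rightarrow> bool) \<Rightarrow> nat \<Rightarrow> bool list" where
  "pref x n = map x [0..<n]"

lemma length_pref [simp]: "length (pref x n) = n"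
  by (simp add: pref_def)

lemma pref_in_words [simp]: "pref x n \<in> words n"
  by (simp add: words_def)

lemma mem_cyl_iff: "x \<in> cyl w \<longleftrightarrow> pref x (length w) = w"
proof
  assume "x \<in> cyl w"
  then show "pref x (length w) = w"
    by (intro nth_equalityI) (auto simp: cyl_def pref_def)
next
  assume *: "pref x (length w) = w"
  have "x i = w ! i" if "i < length w" for i
    using that arg_cong[OF *, of "\<lambda>v. v ! i"] by (simp add: pref_def)
  then show "x \<in> cyl w"
    by (simp add: cyl_def)
qed

lemma mem_cyl_words: "w \<in> words n \<Longrightarrow> x \<in> cyl w \<longleftrightarrow> pref x n = w"
  by (simp add: mem_cyl_iff words_def)

lemma cyl_disjoint: "w \<in> words n \<Longrightarrow> w' \<in> words n \<Longrightarrow> w \<noteq> w' \<Longrightarrow> cyl w \<inter> cyl w' = {}"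
  by (metis disjoint_iff mem_cyl_words)

lemma mem_cyl_pref_iff: "y \<in> cyl (pref x n) \<longleftrightarrow> (\<forall>i<n. x i = y i)"
  by (auto simp: cyl_def pref_def)

lemma mem_cyl_pref_self [simp]: "x \<in> cyl (pref x n)"
  by (simp add: mem_cyl_pref_iff)

lemma cyl_pref_antimono: "m \<le> n \<Longrightarrow> cyl (pref x n) \<subseteq> cyl (pref x m)"
  by (auto simp: mem_cyl_pref_iff)

lemma cdist_le_power_iff: "cdist x y \<le> (1/2) ^ n \<longleftrightarrow> (\<forall>i<n. x i = y i)"
proof (cases "x = y")
  case False
  then have ex: "\<exists>i. x i \<noteq> y i"
    by auto
  let ?l = "LEAST i. x i \<noteq> y i"
  have *: "cdist x y \<le> (1/2) ^ n \<longleftrightarrow> n \<le> ?l"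
    using False power_decreasing_iff[of "1/2::real" ?l n] by (simp add: cdist_def)
  define l where "l = ?l"
  have eq: "x i = y i" if "i < l" for i
    using not_less_Least[OF that[unfolded l_def]] by simp
  have neq: "x l \<noteq> y l"
    unfolding l_def by (rule LeastI_ex[OF ex])
  show ?thesis
    unfolding * l_def[symmetric]
  proof
    assume "\<forall>i<n. x i = y i"
    with neq show "n \<le> l"
      using not_le_imp_less by blast
  qed (use eq in auto)
qed (simp add: cdist_def)

lemma ccball_power: "ccball x ((1/2) ^ n) = cyl (pref x n)"
  by (auto simp: ccball_def cdist_le_power_iff mem_cyl_pref_iff)

lemma cyl_in_cantor_borel: "cyl w \<in> sets cantor_borel"
proof -
  have "copen (cyl w)"
    unfolding copen_def
  proof
    fix x
    assume "x \<in> cyl w"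
    then have "ccball x ((1/2) ^ length w) = cyl w"
      by (simp add: ccball_power mem_cyl_iff)
    moreover have "{y. cdist x y < r} \<subseteq> ccball x r" for r
      by (auto simp: ccball_def)
    ultimately have "{y. cdist x y < (1/2) ^ length w} \<subseteq> cyl w"
      by metis
    then show "\<exists>r>0. {y. cdist x y < r} \<subseteq> cyl w"
      by (intro exI[of _ "(1/2) ^ length w"]) auto
  qed
  then show ?thesis
    by (auto simp: cantor_borel_def)
qed

locale cantor_prob_space = prob_space M for M :: "(nat \<Rightarrow> bool) measure" +
  assumes sets_eq: "sets M = sets cantor_borel"
begin

lemma space_eq_UNIV [simp]: "space M = UNIV"
  using sets_eq_imp_space_eq[OF sets_eq] by (simp add: cantor_borel_def)

lemma cyl_measurable [measurable, simp]: "cyl w \<in> sets M"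
  by (simp add: sets_eq cyl_in_cantor_borel)

lemma pref_pred_eq: "{x. P (pref x n)} = (\<Union>w\<in>{w \<in> words n. P w}. cyl w)"
proof
  show "{x. P (pref x n)} \<subseteq> (\<Union>w\<in>{w \<in> words n. P w}. cyl w)"
  proof
    fix x
    assume "x \<in> {x. P (pref x n)}"
    then show "x \<in> (\<Union>w\<in>{w \<in> words n. P w}. cyl w)"
      by (intro UN_I[of "pref x n"]) auto
  qed
qed (auto simp: mem_cyl_words)

lemma pref_pred_measurable: "Measurable.pred M (\<lambda>x. P (pref x n))"
proof -
  have "{x. P (pref x n)} \<in> sets M"
    unfolding pref_pred_eq[of P n] by (intro sets.finite_UN) auto
  then show ?thesis
    by (simp add: pred_def)
qed

lemma prob_pref:
  "prob {x. P (pref x n)} = (\<Sum>w\<in>{w \<in> words n. P w}. prob (cyl w))"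
  unfolding pref_pred_eq[of P n]
proof (rule finite_measure_finite_Union)
  show "disjoint_family_on cyl {w \<in> words n. P w}"
    unfolding disjoint_family_on_def using cyl_disjoint by blast
qed auto

lemma sum_prob_cyl: "(\<Sum>w\<in>words n. prob (cyl w)) = 1"
  using prob_pref[of "\<lambda>_. True" n] prob_space by simp

text \<open>For each \<open>n\<close> the exceptional set is a finite union of null
  cylinders.\<close>

lemma AE_cyl_pref_pos: "AE x in M. \<forall>n. prob (cyl (pref x n)) > 0"
proof (subst AE_all_countable, intro allI)
  fix n
  have "prob {x. prob (cyl (pref x n)) = 0} = 0"
    using prob_pref[of "\<lambda>w. prob (cyl w) = 0" n] by simp
  then have "AE x in M. x \<notin> {x. prob (cyl (pref x n)) = 0}"
    using pref_pred_measurable[of "\<lambda>w. prob (cyl w) = 0" n]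
    by (subst (asm) prob_eq_0) (auto simp: pred_def)
  then show "AE x in M. prob (cyl (pref x n)) > 0"
    by eventually_elim (simp add: zero_less_measure_iff)
qed

lemma chebyshev_pref:
  assumes "a > 0"
  shows "prob {x. a < \<bar>f (pref x n)\<bar>} \<le> (\<Sum>w\<in>words n. prob (cyl w) * (f w)\<^sup>2) / a\<^sup>2"
proof -
  have "prob {x. a < \<bar>f (pref x n)\<bar>} = (\<Sum>w\<in>{w \<in> words n. a < \<bar>f w\<bar>}. prob (cyl w))"
    by (rule prob_pref[of "\<lambda>w. a < \<bar>f w\<bar>" n])
  also have "\<dots> \<le> (\<Sum>w\<in>{w \<in> words n. a < \<bar>f w\<bar>}. prob (cyl w) * (f w)\<^sup>2 / a\<^sup>2)"
  proof (rule sum_mono)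
    fix w
    assume "w \<in> {w \<in> words n. a < \<bar>f w\<bar>}"
    then have "a\<^sup>2 \<le> (f w)\<^sup>2"
      using assms by (simp add: abs_le_square_iff[symmetric])
    then have "prob (cyl w) * 1 \<le> prob (cyl w) * ((f w)\<^sup>2 / a\<^sup>2)"
      using assms by (intro mult_left_mono) auto
    then show "prob (cyl w) \<le> prob (cyl w) * (f w)\<^sup>2 / a\<^sup>2"
      by simp
  qed
  also have "\<dots> \<le> (\<Sum>w\<in>words n. prob (cyl w) * (f w)\<^sup>2 / a\<^sup>2)"
    by (intro sum_mono2) auto
  finally show ?thesis
    by (simp add: sum_divide_distrib)
qed

text \<open>For a variance linear in \<open>n\<close>, Chebyshev gives only order
  \<open>1 / n\<close>, which is not summable; along \<open>n = m\<^sup>2\<close> it is.\<close>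

lemma AE_eventually_squares:
  fixes K \<eta> :: real
  assumes "\<eta> > 0"
    and var: "\<And>n. (\<Sum>w\<in>words n. prob (cyl w) * (f n w)\<^sup>2) \<le> n * K"
  shows "AE x in M. \<forall>\<^sub>F m in sequentially. \<bar>f (m\<^sup>2) (pref x (m\<^sup>2))\<bar> \<le> \<eta> * real (m\<^sup>2)"
proof -
  define A where "A m = {x. \<eta> * real (m\<^sup>2) < \<bar>f (m\<^sup>2) (pref x (m\<^sup>2))\<bar>}" for m
  have "AE x in M. \<forall>\<^sub>F m in sequentially. x \<in> space M - A m"
  proof (rule borel_cantelli_AE1)
    have "Measurable.pred M (\<lambda>x. \<eta> * real (m\<^sup>2) < \<bar>f (m\<^sup>2) (pref x (m\<^sup>2))\<bar>)" for m
      using pref_pred_measurable[of "\<lambda>w. \<eta> * real (m\<^sup>2) < \<bar>f (m\<^sup>2) w\<bar>" "m\<^sup>2"] by simp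
    then show "A m \<in> sets M" for m
      by (simp add: A_def pred_def)
    show "emeasure M (A m) < \<infinity>" for m
      by (simp add: less_top[symmetric])
    show "summable (\<lambda>m. measure M (A m))"
    proof (rule summable_comparison_test')
      show "summable (\<lambda>m. K / \<eta>\<^sup>2 * inverse (real m ^ 2))"
        by (intro summable_mult inverse_power_summable) auto
      fix m :: nat
      assume m: "m \<ge> 1"
      have "measure M (A m) \<le> (\<Sum>w\<in>words (m\<^sup>2). prob (cyl w) * (f (m\<^sup>2) w)\<^sup>2) / (\<eta> * real (m\<^sup>2))\<^sup>2"
        unfolding A_def using m assms by (intro chebyshev_pref[where f = "f (m\<^sup>2)"]) auto
      also have "\<dots> \<le> (real (m\<^sup>2) * K) / (\<eta> * real (m\<^sup>2))\<^sup>2"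
        using var[of "m\<^sup>2"] by (intro divide_right_mono) auto
      also have "\<dots> = K / \<eta>\<^sup>2 * inverse (real m ^ 2)"
        using m by (simp add: power2_eq_square field_simps)
      finally show "norm (measure M (A m)) \<le> K / \<eta>\<^sup>2 * inverse (real m ^ 2)"
        by simp
    qed
  qed
  then show ?thesis
    by eventually_elim (auto elim!: eventually_mono simp: A_def)
qed

end

text \<open>Monotonicity traps \<open>S n\<close> and \<open>H n\<close> between their values at
  consecutive squares. Of the factor 3, two parts come from the error at the upper square, which is
  at most \<open>2 * n\<close>, and one from the gap \<open>2 * m + 1\<close> between the
  squares.\<close>

lemma eventually_interpolate_squares:
  fixes S H :: "nat \<Rightarrow> real" and \<eta> :: real
  assumes "mono S" and H: "\<And>n. H n \<le> H (Suc n)" "\<And>n. H (Suc n) \<le> H n + 1"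
    and "\<eta> > 0" and ev: "\<forall>\<^sub>F m in sequentially. \<bar>S (m\<^sup>2) - H (m\<^sup>2)\<bar> \<le> \<eta> * real (m\<^sup>2)"
  shows "\<forall>\<^sub>F n in sequentially. \<bar>S n - H n\<bar> \<le> 3 * \<eta> * n"
proof -
  obtain N where N: "\<And>m. m \<ge> N \<Longrightarrow> \<bar>S (m\<^sup>2) - H (m\<^sup>2)\<bar> \<le> \<eta> * real (m\<^sup>2)"
    using ev by (auto simp: eventually_sequentially)
  obtain N' :: nat where N': "3 / \<eta> < N'"
    using reals_Archimedean2 by blast
  \<comment> \<open>Beyond \<open>N'\<close> the gap \<open>2 * m + 1\<close> is at most
    \<open>\<eta> * n\<close>; beyond 3 the next square is at most \<open>2 * n\<close>.\<close>
  define N0 where "N0 = max N (max N' 3)"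
  have H_mono: "H i \<le> H j" if "i \<le> j" for i j
    using that H(1) by (rule lift_Suc_mono_le[rotated])
  have H_lip: "H (i + d) \<le> H i + real d" for i d
    by (induction d) (use H(2) in \<open>auto intro: order_trans[OF H(2)]\<close>)
  have "\<bar>S n - H n\<bar> \<le> 3 * \<eta> * n" if n: "n \<ge> N0\<^sup>2" for n
  proof -
    define m where "m = floor_sqrt n"
    have m: "m\<^sup>2 \<le> n" "n \<le> (Suc m)\<^sup>2" "m \<ge> N0"
      using Suc_floor_sqrt_power2_gt[of n] n by (auto simp: m_def le_floor_sqrt_iff)
    have m3: "3 \<le> real m" "3 / \<eta> \<le> real m"
      using m(3) N' by (auto simp: N0_def)
    have mn: "real m * real m \<le> real n"
      using m(1) by (metis of_nat_le_iff of_nat_mult power2_eq_square)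
    have "3 * real m \<le> \<eta> * real m * real m"
      using m3 \<open>\<eta> > 0\<close> by (intro mult_right_mono) (auto simp: field_simps)
    also have "\<dots> \<le> \<eta> * n"
      using mn \<open>\<eta> > 0\<close> by simp
    finally have lin: "2 * real m + 1 \<le> \<eta> * n"
      using m3(1) by linarith
    have "3 * real m \<le> real m * real m"
      using m3(1) by (intro mult_right_mono) auto
    moreover have "real ((Suc m)\<^sup>2) = real m * real m + 2 * real m + 1"
      by (simp add: power2_eq_square algebra_simps)
    ultimately have "real ((Suc m)\<^sup>2) \<le> 2 * real n"
      using mn m3(1) by linarith
    then have sq: "\<eta> * real ((Suc m)\<^sup>2) \<le> 2 * \<eta> * n"
      using \<open>\<eta> > 0\<close> by simp
    have sq': "\<eta> * real (m\<^sup>2) \<le> \<eta> * n"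
      using \<open>\<eta> > 0\<close> m(1) by simp
    have "(Suc m)\<^sup>2 = m\<^sup>2 + (2 * m + 1)"
      by (simp add: power2_eq_square)
    then have HH: "H ((Suc m)\<^sup>2) \<le> H (m\<^sup>2) + real (2 * m + 1)"
      using H_lip by metis
    have "S (m\<^sup>2) \<le> S n" "S n \<le> S ((Suc m)\<^sup>2)" "H (m\<^sup>2) \<le> H n" "H n \<le> H ((Suc m)\<^sup>2)"
      using m assms(1) H_mono by (auto simp: mono_def)
    moreover have "\<bar>S (m\<^sup>2) - H (m\<^sup>2)\<bar> \<le> \<eta> * real (m\<^sup>2)"
      "\<bar>S ((Suc m)\<^sup>2) - H ((Suc m)\<^sup>2)\<bar> \<le> \<eta> * real ((Suc m)\<^sup>2)"
      using N[of m] N[of "Suc m"] m(3) by (auto simp: N0_def)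
    ultimately show ?thesis
      using HH lin sq sq' unfolding of_nat_add of_nat_mult by linarith
  qed
  then show ?thesis
    by (auto simp: eventually_sequentially)
qed

context transition_kernel
begin

text \<open>Shannon--McMillan--Breiman for the inhomogeneous chain, with the mean entropy depending on \<open>n\<close>.\<close>
lemma AE_information_close_to_entropy:
  fixes \<eta> :: real
  assumes "cantor_prob_space M" and M: "\<And>w. measure M (cyl w) = path_weight 0 False w"
    and "\<eta> > 0"
  shows "AE x in M. \<forall>\<^sub>F n in sequentially.
    \<bar>- ln (measure M (cyl (pref x n))) - mean_sum step_entropy n 0 False\<bar> \<le> \<eta> * n"
proof -
  interpret M: cantor_prob_space M by fact
  \<comment> \<open>At the squares, clipping and Chebyshev cost \<open>\<theta>\<close> each; the
    interpolation multiplies the total by 3.\<close>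
  define \<theta> where "\<theta> = \<eta> / 6"
  have \<theta>: "\<theta> > 0"
    using \<open>\<eta> > 0\<close> by (simp add: \<theta>_def)
  obtain B where B: "B \<ge> 0" "\<And>x. x \<in> {0..1} \<Longrightarrow> binary_entropy x \<le> B * min x (1 - x) + \<theta>"
    using binary_entropy_le_linear[OF \<theta>] by blast
  note clip = clipped_entropy_bounds[OF B]
  define c where "c k a b = - ln (t k a b) - (step_entropy k a - clipped_entropy B k a)" for k a b
  define l where "l k a b = - ln (t k a b)" for k a b
  let ?H = "\<lambda>n. mean_sum step_entropy n 0 False"
  let ?F = "\<lambda>n. mean_sum (clipped_entropy B) n 0 False"
  have cost: "path_cost c k a w \<le> path_cost l k a w \<and>
      path_cost l k a w \<le> path_cost c k a w + \<theta> * length w" for k a w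
  proof (induction w arbitrary: k a)
    case (Cons b w)
    have "c k a b \<le> l k a b" "l k a b \<le> c k a b + \<theta>"
      using clip(2,4)[of k a] by (auto simp: c_def l_def)
    then show ?case
      using Cons[of "Suc k" b] by (simp add: algebra_simps)
  qed simp
  have mean: "?F n \<le> ?H n" "?H n \<le> ?F n + \<theta> * n" for n
    using mean_sum_mono[of "clipped_entropy B" step_entropy 0 n 0 False]
      mean_sum_mono[of step_entropy "clipped_entropy B" \<theta> n 0 False] clip by auto
  have "AE x in M. \<forall>\<^sub>F m in sequentially.
      \<bar>path_cost c 0 False (pref x (m\<^sup>2)) - ?F (m\<^sup>2)\<bar> \<le> \<theta> * real (m\<^sup>2)"
  proof (rule M.AE_eventually_squares)
    show "(\<Sum>w\<in>words n. measure M (cyl w) * (path_cost c 0 False w - ?F n)\<^sup>2) \<le>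
        n * (12 + 2 * B\<^sup>2)" for n
      unfolding M c_def[abs_def] by (rule variance_information) fact
  qed fact
  with M.AE_cyl_pref_pos show ?thesis
  proof eventually_elim
    case (elim x)
    define S where "S n = - ln (measure M (cyl (pref x n)))" for n
    have S: "S n = path_cost l 0 False (pref x n)" for n
      using elim(1) unfolding S_def l_def[abs_def] by (simp add: M path_cost_ln_eq)
    have "mono S"
    proof (rule monoI)
      fix i j :: nat
      assume "i \<le> j"
      then show "S i \<le> S j"
        using elim(1) by (auto simp: S_def intro!: M.finite_measure_mono cyl_pref_antimono)
    qed
    moreover have "\<forall>\<^sub>F m in sequentially. \<bar>S (m\<^sup>2) - ?H (m\<^sup>2)\<bar> \<le> 2 * \<theta> * real (m\<^sup>2)"
      using elim(2)
    proof eventually_elim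
      case (elim m)
      then show ?case
        using mean[of "m\<^sup>2"] cost[of 0 False "pref x (m\<^sup>2)"] unfolding S length_pref by linarith
    qed
    ultimately have "\<forall>\<^sub>F n in sequentially. \<bar>S n - ?H n\<bar> \<le> 3 * (2 * \<theta>) * n"
      using mean_sum_Suc_bounds[of step_entropy, OF step_entropy_bounds] \<theta>
      by (intro eventually_interpolate_squares) auto
    then show ?case
      by (simp add: S_def \<theta>_def)
  qed
qed

end

section \<open>Hausdorff and packing measures on the Cantor space\<close>

lemma half_power_powr: "((1/2::real) ^ n) powr s = 2 powr (- s * n)"
proof -
  have "(1/2::real) ^ n = 2 powr (- real n)"
    by (simp add: powr_minus powr_realpow power_one_over inverse_eq_divide)
  then show ?thesis
    by (simp add: powr_powr mult.commute)
qed

lemma two_powr_eq_power: "2 powr (c * real n) = (2 powr c) ^ n"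
  by (simp add: powr_powr[symmetric] powr_realpow)

lemma cdist_bounds: "0 \<le> cdist x y" "cdist x y \<le> 1"
  by (auto simp: cdist_def power_le_one)

lemma cdist_le_cdiam:
  assumes "x \<in> U" "y \<in> U"
  shows "cdist x y \<le> cdiam U"
proof -
  have "bdd_above ((\<lambda>xy. cdist (fst xy) (snd xy)) ` (U \<times> U))"
    using cdist_bounds(2) by (intro bdd_aboveI2) auto
  then have "cdist (fst (x, y)) (snd (x, y)) \<le> (SUP xy\<in>U \<times> U. cdist (fst xy) (snd xy))"
    using assms by (intro cSUP_upper) auto
  then show ?thesis
    using assms by (auto simp: cdiam_def)
qed

lemma cdiam_nonneg: "0 \<le> cdiam U"
proof (cases "U = {}")
  case False
  then obtain x where "x \<in> U"
    by auto
  then show ?thesis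
    using cdist_le_cdiam[of x U x] by (simp add: cdist_def)
qed (simp add: cdiam_def)

lemma cdiam_cyl_le: "cdiam (cyl w) \<le> (1/2) ^ length w"
proof (cases "cyl w = {}")
  case False
  moreover have "cdist x y \<le> (1/2) ^ length w" if "x \<in> cyl w" "y \<in> cyl w" for x y
    using that by (auto simp: cdist_le_power_iff cyl_def)
  ultimately show ?thesis
    by (auto simp: cdiam_def intro!: cSUP_least)
qed (simp add: cdiam_def)

text \<open>\<open>n\<close> is the first position at which some point of \<open>U\<close> departs
  from \<open>x\<close>, so \<open>U\<close> lies in a cylinder of generation \<open>n\<close> and
  has diameter at least that scale. A singleton has no such position and diameter 0.\<close>

lemma subset_cyl_cases:
  assumes "x \<in> U"
  obtains "U = {x}" | n where "(1/2) ^ n \<le> cdiam U" "U \<subseteq> cyl (pref x n)"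
proof (cases "U = {x}")
  case False
  then obtain z where z: "z \<in> U" "z \<noteq> x"
    using assms by blast
  then obtain k where "z k \<noteq> x k"
    by auto
  with z have ex: "\<exists>n. \<exists>y\<in>U. x n \<noteq> y n"
    by metis
  define n where "n = (LEAST n. \<exists>y\<in>U. x n \<noteq> y n)"
  obtain y where y: "y \<in> U" "x n \<noteq> y n"
    using LeastI_ex[OF ex] unfolding n_def by blast
  have "x i = z i" if "i < n" "z \<in> U" for i z
    using not_less_Least[OF that(1)[unfolded n_def]] that(2) by blast
  then have "U \<subseteq> cyl (pref x n)"
    by (auto simp: mem_cyl_pref_iff)
  moreover have "(1/2) ^ n \<le> cdist x y"
    using y Least_le[of "\<lambda>i. x i \<noteq> y i" n] by (auto simp: cdist_def intro!: power_decreasing)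
  then have "(1/2) ^ n \<le> cdiam U"
    using cdist_le_cdiam[OF assms y(1)] by linarith
  ultimately show ?thesis
    using that by blast
qed (use that in blast)

lemma card_words: "card (words n) = 2 ^ n"
  using card_lists_length_eq[of "UNIV :: bool set" n] by (simp add: words_def)

lemma finite_subset_UN_words:
  fixes W :: "bool list set"
  assumes "finite W"
  obtains K where "W \<subseteq> (\<Union>n<K. words n)"
proof -
  obtain K where "\<forall>l\<in>length ` W. l < K"
    using assms finite_nat_set_iff_bounded by blast
  then show ?thesis
    by (intro that[of K]) (auto simp: words_def)
qed

lemma sum_UN_words: "(\<Sum>w\<in>(\<Union>n<K. words n). g w) = (\<Sum>n<K. \<Sum>w\<in>words n. g w)"
  for g :: "bool list \<Rightarrow> 'a::comm_monoid_add"
proof (rule sum.UNION_disjoint)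
  show "\<forall>i\<in>{..<K}. \<forall>j\<in>{..<K}. i \<noteq> j \<longrightarrow> words i \<inter> words j = {}"
    by (auto simp: words_def)
qed auto

text \<open>Covers are indexed by \<open>nat\<close>, here through an enumeration of all words. An
  initial segment of the enumeration meets finitely many generations, so bounds by generation
  suffice.\<close>

lemma suminf_words_le:
  fixes g :: "bool list \<Rightarrow> ennreal"
  assumes "\<And>K. (\<Sum>n<K. \<Sum>w\<in>words n. g w) \<le> C"
  shows "(\<Sum>i. g (from_nat_into UNIV i)) \<le> C"
proof (rule suminf_le_const[OF summableI])
  fix n
  have "bij_betw (from_nat_into UNIV) UNIV (UNIV :: bool list set)"
    by (intro bij_betw_from_nat_into) (auto simp: infinite_UNIV_listI)
  then have inj: "inj_on (from_nat_into (UNIV :: bool list set)) {..<n}"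
    by (auto simp: bij_betw_def intro: inj_on_subset)
  let ?W = "from_nat_into (UNIV :: bool list set) ` {..<n}"
  obtain K where K: "?W \<subseteq> (\<Union>n<K. words n)"
    using finite_subset_UN_words[of ?W] by blast
  have "(\<Sum>i<n. g (from_nat_into UNIV i)) = (\<Sum>w\<in>?W. g w)"
    using inj by (simp add: sum.reindex)
  also have "\<dots> \<le> (\<Sum>w\<in>(\<Union>n<K. words n). g w)"
    using K by (intro sum_mono2) auto
  also have "\<dots> \<le> C"
    using assms by (simp add: sum_UN_words)
  finally show "(\<Sum>i<n. g (from_nat_into UNIV i)) \<le> C" .
qed

text \<open>For every \<open>N\<close> the cylinders of \<open>G\<close> of generation at least
  \<open>N\<close> cover \<open>E\<close>, and generation \<open>n\<close> contributes at most
  \<open>2 powr ((s - t) * n)\<close>, the term of a convergent geometric series whose tail is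
  small.\<close>

lemma hmeasure_eq_0_if_few_cylinders:
  assumes io: "\<And>x. x \<in> E \<Longrightarrow> \<exists>\<^sub>F n in sequentially. pref x n \<in> G"
    and count: "\<And>n. card (words n \<inter> G) \<le> 2 powr (s * n)"
    and "0 \<le> t" "s < t"
  shows "hmeasure t E = 0"
proof -
  \<comment> \<open>The exponent is halved so that one factor \<open>q ^ n\<close> provides
    smallness, through \<open>q ^ N\<close>, and the other summability.\<close>
  define q where "q = 2 powr ((s - t) / 2)"
  have q: "0 < q" "q < 1"
    using \<open>s < t\<close> by (auto simp: q_def powr_less_one)
  have q2: "2 powr ((s - t) * n) = q ^ n * q ^ n" for n
    by (simp add: q_def two_powr_eq_power[symmetric] powr_add[symmetric] mult.commute)
  have "hcontent \<delta> t E \<le> ennreal e" if "\<delta> > 0" "e > 0" for \<delta> e :: real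
  proof -
    have "(\<lambda>N. (1/2::real) ^ N) \<longlonglongrightarrow> 0" "(\<lambda>N. q ^ N) \<longlonglongrightarrow> 0"
      using q by (auto intro!: LIMSEQ_realpow_zero)
    then have "\<forall>\<^sub>F N in sequentially. (1/2::real) ^ N < \<delta> \<and> q ^ N < e * (1 - q)"
      using that q by (intro eventually_conj order_tendstoD(2)) auto
    then obtain N where N: "(1/2::real) ^ N < \<delta>" "q ^ N < e * (1 - q)"
      by (auto simp: eventually_sequentially)
    define g where "g w = (if w \<in> G \<and> N \<le> length w then ennreal (2 powr (- t * length w)) else 0)" for w
    \<comment> \<open>Rejected words receive the empty set, so that the cover is indexed by all
      words. It costs 0 even for \<open>t = 0\<close>, as \<open>0 powr 0 = 0\<close>.\<close>
    define V where "V w = (if w \<in> G \<and> N \<le> length w then cyl w else {})" for w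
    define U where "U i = V (from_nat_into UNIV i)" for i
    have bij: "bij_betw (from_nat_into UNIV) UNIV (UNIV :: bool list set)"
      by (intro bij_betw_from_nat_into) (auto simp: infinite_UNIV_listI)
    have "E \<subseteq> (\<Union>i. U i)"
    proof
      fix x
      assume "x \<in> E"
      then obtain n where n: "n \<ge> N" "pref x n \<in> G"
        using io[of x] by (auto simp: frequently_sequentially)
      obtain i where "from_nat_into UNIV i = pref x n"
        using bij by (metis UNIV_I bij_betw_def image_iff)
      with n have "x \<in> U i"
        by (simp add: U_def V_def)
      then show "x \<in> (\<Union>i. U i)"
        by blast
    qed
    moreover have "cdiam (V w) \<le> \<delta>" for w
    proof (cases "w \<in> G \<and> N \<le> length w")
      case True
      have "cdiam (cyl w) \<le> (1/2) ^ length w"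
        by (rule cdiam_cyl_le)
      also have "\<dots> \<le> (1/2) ^ N"
        using True by (intro power_decreasing) auto
      finally show ?thesis
        using True N by (simp add: V_def)
    qed (use that in \<open>auto simp: V_def cdiam_def\<close>)
    ultimately have "hcontent \<delta> t E \<le> (\<Sum>i. ennreal (cdiam (U i) powr t))"
      unfolding hcontent_def by (intro INF_lower) (auto simp: U_def)
    also have "\<dots> \<le> (\<Sum>i. g (from_nat_into UNIV i))"
    proof (intro suminf_le summableI)
      have "ennreal (cdiam (V w) powr t) \<le> g w" for w
      proof (cases "w \<in> G \<and> N \<le> length w")
        case True
        have "cdiam (cyl w) powr t \<le> ((1/2) ^ length w) powr t"
          using cdiam_cyl_le cdiam_nonneg \<open>0 \<le> t\<close> by (intro powr_mono2) auto
        then show ?thesis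
          using True by (simp add: V_def g_def half_power_powr ennreal_leI)
      qed (auto simp: V_def g_def cdiam_def)
      then show "ennreal (cdiam (U i) powr t) \<le> g (from_nat_into UNIV i)" for i
        by (simp add: U_def)
    qed
    also have "\<dots> \<le> ennreal e"
    proof (rule suminf_words_le)
      fix K
      have "(\<Sum>w\<in>words n. g w) \<le> ennreal (q ^ N * q ^ n)" for n
      proof (cases "N \<le> n")
        case True
        have "(\<Sum>w\<in>words n. g w) = (\<Sum>w\<in>words n \<inter> G. ennreal (2 powr (- t * n)))"
          using True by (intro sum.mono_neutral_cong_right finite_words) (auto simp: g_def words_def)
        also have "\<dots> = ennreal (card (words n \<inter> G) * 2 powr (- t * n))"
          by (simp add: ennreal_of_nat_eq_real_of_nat ennreal_mult')
        also have "\<dots> \<le> ennreal (2 powr (s * n) * 2 powr (- t * n))"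
          using count by (intro ennreal_leI mult_right_mono) auto
        also have "2 powr (s * n) * 2 powr (- t * n) = q ^ n * q ^ n"
          by (simp add: q2[symmetric] powr_add[symmetric] algebra_simps)
        also have "ennreal (q ^ n * q ^ n) \<le> ennreal (q ^ N * q ^ n)"
          using q True by (intro ennreal_leI mult_right_mono power_decreasing) auto
        finally show ?thesis .
      next
        case False
        then have "(\<Sum>w\<in>words n. g w) = 0"
          by (intro sum.neutral) (auto simp: g_def words_def)
        then show ?thesis
          by simp
      qed
      then have "(\<Sum>n<K. \<Sum>w\<in>words n. g w) \<le> (\<Sum>n<K. ennreal (q ^ N * q ^ n))"
        by (intro sum_mono)
      also have "\<dots> = ennreal (q ^ N * (\<Sum>n<K. q ^ n))"
        using q by (simp add: sum_distrib_left)
      also have "\<dots> \<le> ennreal (q ^ N * (1 / (1 - q)))"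
        using q sum_le_suminf[of "\<lambda>n. q ^ n" "{..<K}"]
        by (intro ennreal_leI mult_left_mono) (auto simp: suminf_geometric summable_geometric)
      also have "\<dots> \<le> ennreal e"
        using N(2) q by (intro ennreal_leI) (simp add: field_simps)
      finally show "(\<Sum>n<K. \<Sum>w\<in>words n. g w) \<le> ennreal e" .
    qed
    finally show ?thesis .
  qed
  then have "hcontent \<delta> t E = 0" if "\<delta> > 0" for \<delta>
    using that ennreal_le_epsilon[of 0 "hcontent \<delta> t E"] by simp
  then show ?thesis
    by (simp add: hmeasure_def)
qed

text \<open>This makes the set in the definition of \<open>hdim\<close> nonempty, so that its
  \<open>Inf\<close> is a genuine infimum.\<close>

lemma hmeasure_2_eq_0: "hmeasure 2 E = 0"
  by (rule hmeasure_eq_0_if_few_cylinders[of _ UNIV 1])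
    (auto simp: card_words powr_realpow)

lemma hdim_leI:
  assumes "0 \<le> s" "\<And>t. s < t \<Longrightarrow> hmeasure t E = 0"
  shows "hdim E \<le> s"
proof (rule field_le_epsilon)
  fix e :: real
  assume "e > 0"
  then show "hdim E \<le> s + e"
    unfolding hdim_def using assms by (intro cInf_lower bdd_belowI[of _ 0]) auto
qed

lemma hdim_geI:
  assumes "\<And>t. 0 \<le> t \<Longrightarrow> t < s \<Longrightarrow> hmeasure t E \<noteq> 0"
  shows "s \<le> hdim E"
  unfolding hdim_def
proof (rule cInf_greatest)
  show "{t. 0 \<le> t \<and> hmeasure t E = 0} \<noteq> {}"
    using hmeasure_2_eq_0[of E] by (auto intro!: exI[of _ 2])
  show "s \<le> t" if "t \<in> {t. 0 \<le> t \<and> hmeasure t E = 0}" for t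
    using assms[of t] that by (cases "t < s") auto
qed

section \<open>Packings by balls and the cylinders inside them\<close>

lemma ball_contains_cyl:
  assumes "0 < r" "r \<le> (1/2) ^ n0" "1 \<le> n0" "0 \<le> t"
  obtains n where "n0 \<le> n" "cyl (pref x n) \<subseteq> ccball x r"
    "(2 * r) powr t \<le> 4 powr t * 2 powr (- t * n)"
proof -
  have ex: "\<exists>n. (1/2::real) ^ n \<le> r"
    using real_arch_pow_inv[of r "1/2"] assms(1) by (auto intro: less_imp_le)
  \<comment> \<open>By minimality the radius is less than twice \<open>(1/2) ^ n\<close>, whence the
    constant \<open>4 powr t\<close>. The assumption \<open>1 \<le> n0\<close> provides the
    predecessor of \<open>n\<close>.\<close>
  define n where "n = (LEAST n. (1/2::real) ^ n \<le> r)"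
  have n: "(1/2) ^ n \<le> r"
    unfolding n_def by (rule LeastI_ex[OF ex])
  then have "(1/2::real) ^ n \<le> (1/2) ^ n0"
    using assms(2) by linarith
  then have "n0 \<le> n"
    using power_decreasing_iff[of "1/2::real" n n0] by simp
  then obtain k where k: "n = Suc k"
    using assms(3) by (cases n) auto
  have "\<not> (1/2) ^ k \<le> r"
    using not_less_Least[of k "\<lambda>n. (1/2::real) ^ n \<le> r"] k by (simp add: n_def)
  then have "2 * r \<le> 4 * (1/2) ^ n"
    by (simp add: k)
  then have "(2 * r) powr t \<le> (4 * (1/2) ^ n) powr t"
    using assms by (intro powr_mono2) auto
  also have "\<dots> = 4 powr t * 2 powr (- t * n)"
    by (simp add: powr_mult half_power_powr)
  finally have "(2 * r) powr t \<le> 4 powr t * 2 powr (- t * n)" .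
  moreover have "cyl (pref x n) \<subseteq> ccball x r"
    unfolding ccball_power[symmetric] using n by (auto simp: ccball_def)
  ultimately show ?thesis
    using that \<open>n0 \<le> n\<close> by blast
qed

lemma ppre_delta_mono: "A \<subseteq> A' \<Longrightarrow> ppre_delta \<delta> t A \<le> ppre_delta \<delta> t A'"
  unfolding ppre_delta_def packings_def by (intro SUP_subset_mono) fastforce+

text \<open>The \<open>2 ^ n\<close> words of length \<open>n\<close> contribute at most
  \<open>(1/2) ^ n\<close> together.\<close>

lemma sum_quarter_power_le:
  fixes W :: "bool list set"
  assumes "finite W"
  shows "(\<Sum>w\<in>W. (1/4::real) ^ length w) \<le> 2"
proof -
  obtain K where K: "W \<subseteq> (\<Union>n<K. words n)"
    using finite_subset_UN_words[OF assms] by blast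
  have "(\<Sum>w\<in>W. (1/4::real) ^ length w) \<le> (\<Sum>w\<in>(\<Union>n<K. words n). (1/4) ^ length w)"
    using K by (intro sum_mono2) auto
  also have "\<dots> = (\<Sum>n<K. \<Sum>w\<in>words n. (1/4) ^ n)"
    unfolding sum_UN_words by (intro sum.cong refl) (auto simp: words_def)
  also have "\<dots> = (\<Sum>n<K. (1/2) ^ n)"
    by (simp add: card_words power_mult_distrib[symmetric])
  also have "\<dots> \<le> 2"
    using sum_le_suminf[of "\<lambda>n. (1/2::real) ^ n" "{..<K}"]
    by (simp add: suminf_geometric summable_geometric)
  finally show ?thesis .
qed

lemma pmeasure_eq_0I:
  fixes F :: "nat \<Rightarrow> (nat \<Rightarrow> bool) set"
  assumes "E \<subseteq> (\<Union>i. F i)" "\<And>i. ppremeasure t (F i) = 0"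
  shows "pmeasure t E = 0"
proof -
  have "pmeasure t E \<le> (\<Sum>i. ppremeasure t (F i))"
    unfolding pmeasure_def using assms(1) by (intro INF_lower) auto
  then show ?thesis
    using assms(2) by simp
qed

lemma ppremeasure_eq_0I:
  assumes "\<And>e. e > 0 \<Longrightarrow> \<exists>\<delta>>0. \<forall>P\<in>packings \<delta> A. (\<Sum>(x, r)\<in>P. (2 * r) powr t) \<le> e"
  shows "ppremeasure t A = 0"
proof -
  have "ppremeasure t A \<le> 0 + ennreal e" if e: "e > 0" for e :: real
  proof -
    obtain \<delta> where \<delta>: "\<delta> > 0" "\<forall>P\<in>packings \<delta> A. (\<Sum>(x, r)\<in>P. (2 * r) powr t) \<le> e"
      using assms[OF e] by blast
    have "ppremeasure t A \<le> ppre_delta \<delta> t A"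
      unfolding ppremeasure_def using \<delta>(1) by (intro INF_lower) auto
    also have "\<dots> \<le> ennreal e"
      unfolding ppre_delta_def
    proof (rule SUP_least)
      fix P
      assume P: "P \<in> packings \<delta> A"
      have "(\<Sum>(x, r)\<in>P. ennreal ((2 * r) powr t)) = ennreal (\<Sum>(x, r)\<in>P. (2 * r) powr t)"
        by (simp add: case_prod_beta sum_ennreal)
      also have "\<dots> \<le> ennreal e"
        using \<delta>(2) P by (intro ennreal_leI) auto
      finally show "(\<Sum>(x, r)\<in>P. ennreal ((2 * r) powr t)) \<le> ennreal e" .
    qed
    finally show ?thesis
      by simp
  qed
  then show ?thesis
    using ennreal_le_epsilon[of 0 "ppremeasure t A"] by simp
qed

text \<open>Each ball is exchanged for a cylinder around its centre; the inclusion lets these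
  cylinders inherit the disjointness of the balls.\<close>

lemma packing_levels:
  assumes P: "P \<in> packings ((1/2) ^ n0) A" and "1 \<le> n0" "0 \<le> t"
  obtains l where "\<And>x r. (x, r) \<in> P \<Longrightarrow> n0 \<le> l (x, r)"
    "\<And>x r. (x, r) \<in> P \<Longrightarrow> cyl (pref x (l (x, r))) \<subseteq> ccball x r"
    "\<And>x r. (x, r) \<in> P \<Longrightarrow> (2 * r) powr t \<le> 4 powr t * 2 powr (- t * l (x, r))"
proof -
  have "\<forall>a\<in>P. \<exists>n. n0 \<le> n \<and> cyl (pref (fst a) n) \<subseteq> ccball (fst a) (snd a) \<and>
      (2 * snd a) powr t \<le> 4 powr t * 2 powr (- t * n)"
  proof
    fix a
    assume "a \<in> P"
    then have "0 < snd a" "snd a \<le> (1/2) ^ n0"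
      using P by (auto simp: packings_def)
    from ball_contains_cyl[OF this assms(2,3), of "fst a"]
    show "\<exists>n. n0 \<le> n \<and> cyl (pref (fst a) n) \<subseteq> ccball (fst a) (snd a) \<and>
      (2 * snd a) powr t \<le> 4 powr t * 2 powr (- t * n)"
      by metis
  qed
  then obtain l where "\<forall>a\<in>P. n0 \<le> l a \<and> cyl (pref (fst a) (l a)) \<subseteq> ccball (fst a) (snd a) \<and>
      (2 * snd a) powr t \<le> 4 powr t * 2 powr (- t * l a)"
    by metis
  then show ?thesis
    by (intro that[of l]) force+
qed

lemma packing_disjoint:
  assumes "P \<in> packings \<delta> A" "a \<in> P" "b \<in> P" "a \<noteq> b"
  shows "ccball (fst a) (snd a) \<inter> ccball (fst b) (snd b) = {}"
  using assms by (auto simp: packings_def)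

text \<open>The analogue of \<open>hmeasure_2_eq_0\<close> for \<open>pdim\<close>. The weight
  \<open>2 powr (- 3 * n)\<close> splits into \<open>(1/4) ^ n\<close>, summable over all words, and
  \<open>(1/2) ^ n\<close>, small at fine scales.\<close>

lemma ppremeasure_3_eq_0: "ppremeasure 3 A = 0"
proof (rule ppremeasure_eq_0I)
  fix e :: real
  assume "e > 0"
  have "(\<lambda>n. (1/2::real) ^ n) \<longlonglongrightarrow> 0"
    by (intro LIMSEQ_realpow_zero) auto
  \<comment> \<open>128 is \<open>4 powr 3\<close> times the bound 2 of
    \<open>sum_quarter_power_le\<close>.\<close>
  then have "\<forall>\<^sub>F n in sequentially. (1/2::real) ^ n < e / 128 \<and> 1 \<le> n"
    using \<open>e > 0\<close> by (intro eventually_conj order_tendstoD(2) eventually_ge_at_top) auto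
  then obtain n0 where n0: "(1/2::real) ^ n0 < e / 128" "1 \<le> n0"
    by (auto simp: eventually_sequentially)
  have "(\<Sum>(x, r)\<in>P. (2 * r) powr 3) \<le> e" if P: "P \<in> packings ((1/2) ^ n0) A" for P
  proof -
    obtain l where l: "\<And>x r. (x, r) \<in> P \<Longrightarrow> n0 \<le> l (x, r)"
      "\<And>x r. (x, r) \<in> P \<Longrightarrow> cyl (pref x (l (x, r))) \<subseteq> ccball x r"
      "\<And>x r. (x, r) \<in> P \<Longrightarrow> (2 * r) powr 3 \<le> 4 powr 3 * 2 powr (- 3 * l (x, r))"
      using packing_levels[OF P n0(2), of 3] by auto
    define w where "w a = pref (fst a) (l a)" for a
    have "finite P"
      using P by (simp add: packings_def)
    have inj: "inj_on w P"
    proof (rule inj_onI, rule ccontr)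
      fix a b
      assume ab: "a \<in> P" "b \<in> P" "w a = w b" "a \<noteq> b"
      have "cyl (w a) \<subseteq> ccball (fst a) (snd a)" "cyl (w b) \<subseteq> ccball (fst b) (snd b)"
        using l(2)[of "fst a" "snd a"] l(2)[of "fst b" "snd b"] ab by (auto simp: w_def)
      moreover have "fst a \<in> cyl (w a)"
        by (simp add: w_def)
      ultimately show False
        using packing_disjoint[OF P ab(1,2,4)] ab(3) by auto
    qed
    have "(2 * r) powr 3 \<le> 64 * (1/2) ^ n0 * (1/4) ^ length (w (x, r))" if "(x, r) \<in> P" for x r
    proof -
      let ?n = "l (x, r)"
      have "2 powr (- 3 * real ?n) = (1/2) ^ ?n * (1/4) ^ ?n"
        by (simp add: two_powr_eq_power powr_minus powr_numeral power_mult_distrib[symmetric] power_one_over inverse_eq_divide)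
      also have "\<dots> \<le> (1/2) ^ n0 * (1/4) ^ ?n"
        using l(1)[OF that] by (intro mult_right_mono power_decreasing) auto
      finally show ?thesis
        using l(3)[OF that] by (simp add: w_def powr_numeral)
    qed
    then have "(\<Sum>(x, r)\<in>P. (2 * r) powr 3) \<le> (\<Sum>a\<in>P. 64 * (1/2) ^ n0 * (1/4) ^ length (w a))"
      by (intro sum_mono) auto
    also have "\<dots> = 64 * (1/2) ^ n0 * (\<Sum>v\<in>w ` P. (1/4) ^ length v)"
      by (simp add: sum.reindex[OF inj] sum_distrib_left)
    also have "\<dots> \<le> 64 * (1/2) ^ n0 * 2"
      using \<open>finite P\<close> by (intro mult_left_mono sum_quarter_power_le) auto
    also have "\<dots> \<le> e"
      using n0(1) by simp
    finally show ?thesis .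
  qed
  then show "\<exists>\<delta>>0. \<forall>P\<in>packings \<delta> A. (\<Sum>(x, r)\<in>P. (2 * r) powr 3) \<le> e"
    by (intro exI[of _ "(1/2) ^ n0"]) auto
qed

lemma pdim_leI:
  assumes "0 \<le> s" "\<And>t. s < t \<Longrightarrow> pmeasure t E = 0"
  shows "pdim E \<le> s"
proof (rule field_le_epsilon)
  fix e :: real
  assume "e > 0"
  then show "pdim E \<le> s + e"
    unfolding pdim_def using assms by (intro cInf_lower bdd_belowI[of _ 0]) auto
qed

lemma pdim_geI:
  assumes "\<And>t. 0 \<le> t \<Longrightarrow> t < s \<Longrightarrow> pmeasure t E \<noteq> 0"
  shows "s \<le> pdim E"
  unfolding pdim_def
proof (rule cInf_greatest)
  have "pmeasure 3 E = 0"
    by (rule pmeasure_eq_0I[of _ "\<lambda>_. E"]) (auto simp: ppremeasure_3_eq_0)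
  then show "{t. 0 \<le> t \<and> pmeasure t E = 0} \<noteq> {}"
    by (auto intro!: exI[of _ 3])
  show "s \<le> t" if "t \<in> {t. 0 \<le> t \<and> pmeasure t E = 0}" for t
    using assms[of t] that by (cases "t < s") auto
qed

section \<open>Dimension estimates from cylinder masses\<close>

context cantor_prob_space
begin

lemma cyl_pref_pred_measurable:
  "Measurable.pred M (\<lambda>x. c \<le> prob (cyl (pref x n)))"
  "Measurable.pred M (\<lambda>x. prob (cyl (pref x n)) \<le> c)"
  using pref_pred_measurable[of "\<lambda>w. c \<le> prob (cyl w)" n]
    pref_pred_measurable[of "\<lambda>w. prob (cyl w) \<le> c" n] by simp_all

text \<open>The masses in one generation add up to 1, so at most \<open>2 powr (s * n)\<close>
  cylinders are as heavy as required, and every point of a set of full measure lies in infinitely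
  many of them.\<close>

lemma exists_small_hdim:
  fixes s :: real
  assumes "0 \<le> s"
    and io: "AE x in M. \<exists>\<^sub>F n in sequentially. 2 powr (- s * n) \<le> prob (cyl (pref x n))"
  shows "\<exists>E\<in>sets M. prob E > 0 \<and> hdim E \<le> s"
proof -
  define E where "E = {x. \<forall>N. \<exists>n. N \<le> n \<and> 2 powr (- s * n) \<le> prob (cyl (pref x n))}"
  have "Measurable.pred M (\<lambda>x. \<forall>N. \<exists>n. N \<le> n \<and> 2 powr (- s * n) \<le> prob (cyl (pref x n)))"
    by (intro pred_intros_countable pred_intros_imp' pred_intros_conj1' cyl_pref_pred_measurable)
  then have E: "E \<in> sets M"
    by (simp add: E_def pred_def)
  have "AE x in M. x \<in> E"
    using io by eventually_elim (auto simp: E_def frequently_sequentially)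
  then have "prob E = 1"
    using E by (simp add: prob_eq_1)
  moreover have "hdim E \<le> s"
  proof (rule hdim_leI)
    fix t
    assume "s < t"
    define G where "G = {w. 2 powr (- s * length w) \<le> prob (cyl w)}"
    show "hmeasure t E = 0"
    proof (rule hmeasure_eq_0_if_few_cylinders)
      show "\<exists>\<^sub>F n in sequentially. pref x n \<in> G" if "x \<in> E" for x
        using that by (auto simp: E_def G_def frequently_sequentially)
      show "card (words n \<inter> G) \<le> 2 powr (s * n)" for n
      proof -
        have "card (words n \<inter> G) * 2 powr (- s * n) = (\<Sum>w\<in>words n \<inter> G. 2 powr (- s * n))"
          by simp
        also have "\<dots> \<le> (\<Sum>w\<in>words n \<inter> G. prob (cyl w))"
          by (intro sum_mono) (auto simp: G_def words_def)
        also have "\<dots> \<le> (\<Sum>w\<in>words n. prob (cyl w))"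
          by (intro sum_mono2) auto
        also have "\<dots> = 1"
          by (rule sum_prob_cyl)
        finally show ?thesis
          by (simp add: powr_minus field_simps)
      qed
    qed (use assms \<open>s < t\<close> in auto)
  qed fact
  ultimately show ?thesis
    using E by (intro bexI[of _ E]) auto
qed

text \<open>Needed because a one-point covering set has diameter 0 and hence costs nothing.\<close>

lemma prob_singleton_eq_0:
  fixes s :: real
  assumes "0 < s" and "\<And>n. N \<le> n \<Longrightarrow> prob (cyl (pref x n)) \<le> 2 powr (- s * n)"
  shows "{x} \<in> sets M" "prob {x} = 0"
proof -
  have "y = x" if "\<And>n. y \<in> cyl (pref x n)" for y
    using that[of "Suc _"] by (auto simp: mem_cyl_pref_iff)
  then have "{x} = (\<Inter>n. cyl (pref x n))"
    by auto
  also have "\<dots> \<in> sets M"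
    by (intro sets.countable_INT) auto
  finally show x: "{x} \<in> sets M" .
  have "prob {x} \<le> 0"
  proof (rule LIMSEQ_le_const)
    show "(\<lambda>n. (2 powr (- s)) ^ n) \<longlonglongrightarrow> 0"
      using assms(1) by (intro LIMSEQ_realpow_zero) (auto simp: powr_less_one)
    have "prob {x} \<le> (2 powr (- s)) ^ n" if "N \<le> n" for n
    proof -
      have "prob {x} \<le> prob (cyl (pref x n))"
        by (intro finite_measure_mono) auto
      also have "\<dots> \<le> 2 powr (- s * n)"
        using assms(2) that .
      finally show ?thesis
        by (simp only: two_powr_eq_power)
    qed
    then show "\<exists>N. \<forall>n\<ge>N. prob {x} \<le> (2 powr (- s)) ^ n"
      by blast
  qed
  then show "prob {x} = 0"
    by (simp add: antisym)
qed

text \<open>Mass distribution principle. The bound on the masses holds from a common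
  \<open>N\<close> on over a subset of \<open>E\<close> of positive measure. A covering set that
  meets this subset lies in a point or cylinder whose mass is at most its cost, so no cover can be
  cheaper than the measure of the subset.\<close>

lemma hdim_lower_bound:
  fixes s :: real
  assumes ev: "AE x in M. \<forall>\<^sub>F n in sequentially. prob (cyl (pref x n)) \<le> 2 powr (- s * n)"
    and E: "E \<in> sets M" "prob E > 0"
  shows "s \<le> hdim E"
proof (rule hdim_geI)
  fix t :: real
  assume t: "0 \<le> t" "t < s"
  define A where "A N = {x \<in> E. \<forall>n. N \<le> n \<longrightarrow> prob (cyl (pref x n)) \<le> 2 powr (- s * n)}" for N
  have A: "A N \<in> sets M" for N
  proof -
    have "Measurable.pred M (\<lambda>x. \<forall>n. N \<le> n \<longrightarrow> prob (cyl (pref x n)) \<le> 2 powr (- s * n))"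
      by (intro pred_intros_countable pred_intros_imp' cyl_pref_pred_measurable)
    then have "{x. \<forall>n. N \<le> n \<longrightarrow> prob (cyl (pref x n)) \<le> 2 powr (- s * n)} \<in> sets M"
      by (simp add: pred_def)
    then show ?thesis
      unfolding A_def using E(1) by (simp add: Collect_conj_eq sets.Int)
  qed
  have "\<exists>N. prob (A N) > 0"
  proof (rule ccontr)
    assume "\<not> (\<exists>N. prob (A N) > 0)"
    then have "prob (A N) = 0" for N
      by (simp add: zero_less_measure_iff)
    then have "AE x in M. \<forall>N. x \<notin> A N"
      using prob_eq_0[OF A] by (subst AE_all_countable) simp
    with ev have "AE x in M. x \<notin> E"
      by eventually_elim (auto simp: A_def eventually_sequentially)
    then show False
      using prob_eq_0[OF E(1)] E(2) by simp
  qed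
  then obtain N where N: "prob (A N) > 0"
    by blast
  show "hmeasure t E \<noteq> 0"
  proof
    assume "hmeasure t E = 0"
    \<comment> \<open>At scale \<open>(1/2) ^ N\<close> the enclosing cylinders have generation at
      least \<open>N\<close>, where the mass bound applies.\<close>
    moreover have "hcontent ((1/2) ^ N) t E \<le> hmeasure t E"
      unfolding hmeasure_def by (intro SUP_upper) auto
    ultimately have "hcontent ((1/2) ^ N) t E < emeasure M (A N)"
      using N by (simp add: emeasure_eq_measure)
    then obtain U where U: "E \<subseteq> (\<Union>i. U i)" "\<And>i. cdiam (U i) \<le> (1/2) ^ N"
      "(\<Sum>i. ennreal (cdiam (U i) powr t)) < emeasure M (A N)"
      unfolding hcontent_def INF_less_iff by auto
    \<comment> \<open>The sets of a cover need not be measurable, so each trace on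
      \<open>A N\<close> is enclosed in a measurable set: empty, a null point or a cylinder.\<close>
    have "\<exists>V. V \<in> sets M \<and> U i \<inter> A N \<subseteq> V \<and> emeasure M V \<le> ennreal (cdiam (U i) powr t)" for i
    proof (cases "U i \<inter> A N = {}")
      case True
      then show ?thesis
        by (intro exI[of _ "{}"]) auto
    next
      case False
      then obtain x where x: "x \<in> U i" "x \<in> A N"
        by auto
      then have small: "prob (cyl (pref x n)) \<le> 2 powr (- s * n)" if "N \<le> n" for n
        using that by (auto simp: A_def)
      from x(1) show ?thesis
      proof (cases rule: subset_cyl_cases)
        case 1
        then show ?thesis
          using prob_singleton_eq_0[OF _ small, of N] t
          by (intro exI[of _ "{x}"]) (auto simp: emeasure_eq_measure)
      next
        case (2 n)
        then have "(1/2::real) ^ n \<le> (1/2) ^ N"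
          using U(2)[of i] by linarith
        then have "N \<le> n"
          using power_decreasing_iff[of "1/2::real" n N] by simp
        then have "prob (cyl (pref x n)) \<le> 2 powr (- s * n)"
          by (rule small)
        also have "\<dots> \<le> 2 powr (- t * n)"
          using t by (intro powr_mono mult_right_mono) auto
        also have "\<dots> = ((1/2) ^ n) powr t"
          by (simp add: half_power_powr)
        also have "\<dots> \<le> cdiam (U i) powr t"
          using 2 t by (intro powr_mono2) auto
        finally show ?thesis
          using 2 by (intro exI[of _ "cyl (pref x n)"]) (auto simp: emeasure_eq_measure ennreal_leI)
      qed
    qed
    then obtain V where V: "\<And>i. V i \<in> sets M" "\<And>i. U i \<inter> A N \<subseteq> V i"
      "\<And>i. emeasure M (V i) \<le> ennreal (cdiam (U i) powr t)"
      by metis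
    have "A N \<subseteq> (\<Union>i. V i)"
      using U(1) V(2) by (fastforce simp: A_def)
    then have "emeasure M (A N) \<le> emeasure M (\<Union>i. V i)"
      using V(1) by (intro emeasure_mono sets.countable_UN) auto
    also have "\<dots> \<le> (\<Sum>i. emeasure M (V i))"
      using V(1) by (intro emeasure_subadditive_countably) auto
    also have "\<dots> \<le> (\<Sum>i. ennreal (cdiam (U i) powr t))"
      using V(3) by (intro suminf_le summableI)
    finally show False
      using U(3) by simp
  qed
qed

text \<open>On \<open>F N\<close> the lower mass bound is uniform, so the weight of a small ball is
  at most \<open>e\<close> times the mass of a cylinder inside it. These cylinders are disjoint,
  hence the total is at most \<open>e\<close>. The countable union over \<open>N\<close> is absorbed
  by the definition of \<open>pmeasure\<close>.\<close>

lemma exists_small_pdim: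
  fixes s :: real
  assumes "0 \<le> s"
    and ev: "AE x in M. \<forall>\<^sub>F n in sequentially. 2 powr (- s * n) \<le> prob (cyl (pref x n))"
  shows "\<exists>E\<in>sets M. prob E > 0 \<and> pdim E \<le> s"
proof -
  define F where "F N = {x. \<forall>n. N \<le> n \<longrightarrow> 2 powr (- s * n) \<le> prob (cyl (pref x n))}" for N
  have F: "F N \<in> sets M" for N
  proof -
    have "Measurable.pred M (\<lambda>x. \<forall>n. N \<le> n \<longrightarrow> 2 powr (- s * n) \<le> prob (cyl (pref x n)))"
      by (intro pred_intros_countable pred_intros_imp' pred_intros_conj1' cyl_pref_pred_measurable)
    then show ?thesis
      by (simp add: F_def pred_def)
  qed
  then have E: "(\<Union>N. F N) \<in> sets M"
    by (intro sets.countable_UN) auto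
  have "AE x in M. x \<in> (\<Union>N. F N)"
    using ev by eventually_elim (auto simp: F_def eventually_sequentially)
  then have "prob (\<Union>N. F N) = 1"
    using E by (simp add: prob_eq_1)
  moreover have "pdim (\<Union>N. F N) \<le> s"
  proof (rule pdim_leI)
    fix t
    assume "s < t"
    have "ppremeasure t (F N) = 0" for N
    proof (rule ppremeasure_eq_0I)
      fix e :: real
      assume "e > 0"
      define q where "q = 2 powr (s - t)"
      have q: "0 < q" "q < 1"
        using \<open>s < t\<close> by (auto simp: q_def powr_less_one)
      \<comment> \<open>The power of \<open>q\<close> absorbs the constant of
        \<open>packing_levels\<close>, which also asks for a level at least 1; beyond
        \<open>N\<close> the points of \<open>F N\<close> obey their mass bound.\<close>
      have "\<forall>\<^sub>F n in sequentially. q ^ n < e / 4 powr t \<and> max 1 N \<le> n"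
        using \<open>e > 0\<close> q
        by (intro eventually_conj order_tendstoD(2)[OF LIMSEQ_realpow_zero] eventually_ge_at_top) auto
      then obtain n0 where n0: "q ^ n0 < e / 4 powr t" "1 \<le> n0" "N \<le> n0"
        by (auto simp: eventually_sequentially)
      have "(\<Sum>(x, r)\<in>P. (2 * r) powr t) \<le> e" if P: "P \<in> packings ((1/2) ^ n0) (F N)" for P
      proof -
        obtain l where l: "\<And>x r. (x, r) \<in> P \<Longrightarrow> n0 \<le> l (x, r)"
          "\<And>x r. (x, r) \<in> P \<Longrightarrow> cyl (pref x (l (x, r))) \<subseteq> ccball x r"
          "\<And>x r. (x, r) \<in> P \<Longrightarrow> (2 * r) powr t \<le> 4 powr t * 2 powr (- t * l (x, r))"
          using packing_levels[OF P n0(2), of t] \<open>0 \<le> s\<close> \<open>s < t\<close> by auto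
        define C where "C a = cyl (pref (fst a) (l a))" for a
        have "(2 * r) powr t \<le> e * prob (C (x, r))" if xr: "(x, r) \<in> P" for x r
        proof -
          let ?n = "l (x, r)"
          have "x \<in> F N"
            using P xr by (auto simp: packings_def)
          then have *: "2 powr (- s * ?n) \<le> prob (C (x, r))"
            using l(1)[OF xr] n0(3) by (auto simp: F_def C_def)
          have "4 powr t * q ^ ?n \<le> 4 powr t * q ^ n0"
            using q l(1)[OF xr] by (intro mult_left_mono power_decreasing) auto
          also have "\<dots> \<le> e"
            using n0(1) by (simp add: field_simps)
          finally have **: "4 powr t * q ^ ?n \<le> e" .
          have "(2 * r) powr t \<le> 4 powr t * 2 powr (- t * ?n)"
            by (rule l(3)[OF xr])
          also have "\<dots> = (4 powr t * q ^ ?n) * 2 powr (- s * ?n)"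
            by (simp add: q_def two_powr_eq_power[symmetric] powr_add[symmetric] algebra_simps)
          also have "\<dots> \<le> e * prob (C (x, r))"
            using * ** \<open>e > 0\<close> by (intro mult_mono) auto
          finally show ?thesis .
        qed
        then have "(\<Sum>(x, r)\<in>P. (2 * r) powr t) \<le> (\<Sum>a\<in>P. e * prob (C a))"
          by (intro sum_mono) auto
        also have "\<dots> = e * prob (\<Union>a\<in>P. C a)"
        proof -
          have "C a \<subseteq> ccball (fst a) (snd a)" if "a \<in> P" for a
            using l(2)[of "fst a" "snd a"] that by (auto simp: C_def)
          then have "disjoint_family_on C P"
            unfolding disjoint_family_on_def using packing_disjoint[OF P] by blast
          moreover have "finite P" "C ` P \<subseteq> sets M"
            using P by (auto simp: packings_def C_def)
          ultimately have "prob (\<Union>a\<in>P. C a) = (\<Sum>a\<in>P. prob (C a))"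
            by (intro finite_measure_finite_Union)
          then show ?thesis
            by (simp add: sum_distrib_left)
        qed
        also have "\<dots> \<le> e"
          using \<open>e > 0\<close> by (simp add: mult_left_le)
        finally show ?thesis .
      qed
      then show "\<exists>\<delta>>0. \<forall>P\<in>packings \<delta> (F N). (\<Sum>(x, r)\<in>P. (2 * r) powr t) \<le> e"
        by (intro exI[of _ "(1/2) ^ n0"]) auto
    qed
    then show "pmeasure t (\<Union>N. F N) = 0"
      by (intro pmeasure_eq_0I) auto
  qed fact
  ultimately show ?thesis
    using E by (intro bexI[of _ "\<Union>N. F N"]) auto
qed

text \<open>A packing by balls of radius \<open>2\<^sup>-\<^sup>n\<close> bounds the number of generation-\<open>n\<close> cylinders that meet
  \<open>A\<close>, so those among them of small measure have summable total mass.\<close>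
lemma null_cover_if_ppre_delta_finite:
  fixes s t :: real
  assumes t: "0 \<le> t" "t < s" and "\<delta> > 0" and pre: "ppre_delta \<delta> t A \<le> 1"
    and io: "\<And>x. x \<in> A \<Longrightarrow> \<exists>\<^sub>F n in sequentially. prob (cyl (pref x n)) \<le> 2 powr (- s * n)"
  shows "\<exists>Z\<in>null_sets M. A \<subseteq> Z"
proof -
  define W where "W n = {w \<in> words n. prob (cyl w) \<le> 2 powr (- s * n) \<and> cyl w \<inter> A \<noteq> {}}" for n
  define D where "D n = (\<Union>w\<in>W n. cyl w)" for n
  have finW: "finite (W n)" for n
    by (simp add: W_def)
  have D: "D n \<in> sets M" for n
    unfolding D_def using finW by (intro sets.finite_UN) auto
  have count: "card (W n) * 2 powr (- t * n) \<le> 1" if n: "(1/2) ^ n \<le> \<delta>" for n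
  proof -
    have "\<forall>w\<in>W n. \<exists>x. x \<in> cyl w \<inter> A"
      by (auto simp: W_def)
    then obtain pt where pt: "\<And>w. w \<in> W n \<Longrightarrow> pt w \<in> cyl w \<inter> A"
      by metis
    have pref_pt: "pref (pt w) n = w" if "w \<in> W n" for w
      using pt[OF that] that mem_cyl_words[of w n "pt w"] by (simp add: W_def)
    define P where "P = (\<lambda>w. (pt w, (1/2::real) ^ n)) ` W n"
    have inj: "inj_on (\<lambda>w. (pt w, (1/2::real) ^ n)) (W n)"
      using pref_pt by (intro inj_onI) (metis prod.inject)
    have "P \<in> packings \<delta> A"
      unfolding packings_def
    proof (intro CollectI conjI ballI impI)
      show "finite P"
        using finW by (simp add: P_def)
      show "case a of (x, r) \<Rightarrow> x \<in> A \<and> 0 < r \<and> r \<le> \<delta>" if "a \<in> P" for a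
        using that pt n by (auto simp: P_def)
      fix a b
      assume "a \<in> P" "b \<in> P" "a \<noteq> b"
      then obtain v w where "a = (pt v, (1/2) ^ n)" "b = (pt w, (1/2) ^ n)" "v \<in> W n" "w \<in> W n" "v \<noteq> w"
        by (auto simp: P_def)
      then show "ccball (fst a) (snd a) \<inter> ccball (fst b) (snd b) = {}"
        using cyl_disjoint[of v n w] by (simp add: ccball_power pref_pt W_def)
    qed
    then have "(\<Sum>(x, r)\<in>P. ennreal ((2 * r) powr t)) \<le> ppre_delta \<delta> t A"
      unfolding ppre_delta_def by (intro SUP_upper)
    also have "\<dots> \<le> 1"
      by (rule pre)
    finally have "(\<Sum>w\<in>W n. ennreal ((2 * (1/2) ^ n) powr t)) \<le> 1"
      unfolding P_def using inj by (simp add: sum.reindex)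
    moreover have "(\<Sum>w\<in>W n. ennreal ((2 * (1/2) ^ n) powr t)) =
        ennreal (card (W n) * (2 * (1/2) ^ n) powr t)"
      by (simp add: ennreal_of_nat_eq_real_of_nat ennreal_mult')
    ultimately have *: "card (W n) * (2 * (1/2) ^ n) powr t \<le> 1"
      by simp
    have "2 powr (- t * n) = ((1/2) ^ n) powr t"
      by (simp add: half_power_powr)
    also have "\<dots> \<le> (2 * (1/2) ^ n) powr t"
      using t by (intro powr_mono2) auto
    finally have "card (W n) * 2 powr (- t * n) \<le> card (W n) * (2 * (1/2) ^ n) powr t"
      by (intro mult_left_mono) auto
    with * show ?thesis
      by linarith
  qed
  define q where "q = 2 powr (t - s)"
  have q: "0 < q" "q < 1"
    using t by (auto simp: q_def powr_less_one)
  have "\<forall>\<^sub>F n in sequentially. (1/2::real) ^ n < \<delta>"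
    using \<open>\<delta> > 0\<close> by (intro order_tendstoD(2)[OF LIMSEQ_realpow_zero]) auto
  then obtain N where N: "\<And>n. N \<le> n \<Longrightarrow> (1/2::real) ^ n < \<delta>"
    by (auto simp: eventually_sequentially)
  have "summable (\<lambda>n. prob (D n))"
  proof (rule summable_comparison_test')
    show "summable (\<lambda>n. q ^ n)"
      using q by (simp add: summable_geometric)
    fix n
    assume "N \<le> n"
    then have c: "card (W n) * 2 powr (- t * n) \<le> 1"
      using N[of n] by (intro count) auto
    have "prob (D n) \<le> (\<Sum>w\<in>W n. prob (cyl w))"
      unfolding D_def using finW by (intro finite_measure_subadditive_finite) auto
    also have "\<dots> \<le> (\<Sum>w\<in>W n. 2 powr (- s * n))"
      by (intro sum_mono) (auto simp: W_def)
    also have "\<dots> = (card (W n) * 2 powr (- t * n)) * q ^ n"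
      by (simp add: q_def two_powr_eq_power[symmetric] powr_add[symmetric] algebra_simps)
    also have "\<dots> \<le> 1 * q ^ n"
      using c q by (intro mult_right_mono) auto
    finally show "norm (prob (D n)) \<le> q ^ n"
      by simp
  qed
  \<comment> \<open>Borel--Cantelli; a point of \<open>A\<close> belongs to \<open>D n\<close> for
    each of its infinitely many light cylinders.\<close>
  then have "limsup D \<in> null_sets M"
    using D by (intro borel_cantelli_limsup1) (auto simp: less_top[symmetric])
  moreover have "A \<subseteq> limsup D"
  proof
    fix x
    assume x: "x \<in> A"
    have "\<exists>m\<ge>n. x \<in> D m" for n
    proof -
      obtain m where m: "m \<ge> n" "prob (cyl (pref x m)) \<le> 2 powr (- s * m)"
        using io[OF x] by (auto simp: frequently_sequentially)
      moreover have "cyl (pref x m) \<inter> A \<noteq> {}"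
        using x mem_cyl_pref_self by blast
      ultimately have "pref x m \<in> W m"
        by (simp add: W_def)
      then show ?thesis
        using m(1) mem_cyl_pref_self unfolding D_def by blast
    qed
    then show "x \<in> limsup D"
      by (auto simp: limsup_INF_SUP)
  qed
  ultimately show ?thesis
    by blast
qed

text \<open>Vanishing packing measure gives a countable cover by sets of premeasure below 1. Each of
  these is null after restriction to the points with infinitely many light cylinders, which makes
  \<open>E\<close> null.\<close>

lemma pdim_lower_bound:
  fixes s :: real
  assumes io: "AE x in M. \<exists>\<^sub>F n in sequentially. prob (cyl (pref x n)) \<le> 2 powr (- s * n)"
    and E: "E \<in> sets M" "prob E > 0"
  shows "s \<le> pdim E"
proof (rule pdim_geI)
  fix t :: real
  assume t: "0 \<le> t" "t < s"
  show "pmeasure t E \<noteq> 0"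
  proof
    assume "pmeasure t E = 0"
    then have "pmeasure t E < 1"
      by simp
    then obtain F where F: "E \<subseteq> (\<Union>i. F i)" "(\<Sum>i. ppremeasure t (F i)) < 1"
      unfolding pmeasure_def INF_less_iff by auto
    \<comment> \<open>The covering sets are arbitrary, so \<open>A i\<close> need not be measurable;
      only its enclosure in a null set is used.\<close>
    define A where "A i = {x \<in> F i. \<exists>\<^sub>F n in sequentially. prob (cyl (pref x n)) \<le> 2 powr (- s * n)}" for i
    have "\<exists>Z\<in>null_sets M. A i \<subseteq> Z" for i
    proof -
      have "ppremeasure t (F i) \<le> (\<Sum>i. ppremeasure t (F i))"
        using sum_le_suminf[of "\<lambda>i. ppremeasure t (F i)" "{i}"] by (simp add: summableI)
      then have "ppremeasure t (F i) < 1"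
        using F(2) by (rule le_less_trans)
      then obtain \<delta> where \<delta>: "\<delta> > 0" "ppre_delta \<delta> t (F i) < 1"
        unfolding ppremeasure_def INF_less_iff by auto
      have "ppre_delta \<delta> t (A i) \<le> ppre_delta \<delta> t (F i)"
        by (intro ppre_delta_mono) (auto simp: A_def)
      then have "ppre_delta \<delta> t (A i) \<le> 1"
        using \<delta>(2) by (meson less_imp_le order_trans)
      then show ?thesis
        using t \<delta>(1) by (intro null_cover_if_ppre_delta_finite[of t s]) (auto simp: A_def)
    qed
    then obtain Z where Z: "\<And>i. Z i \<in> null_sets M" "\<And>i. A i \<subseteq> Z i"
      by metis
    have "AE x in M. \<forall>i. x \<notin> Z i"
      using Z(1) AE_not_in by (subst AE_all_countable) auto
    with io have "AE x in M. x \<notin> E"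
    proof eventually_elim
      case (elim x)
      show ?case
      proof
        assume "x \<in> E"
        then obtain i where "x \<in> F i"
          using F(1) by blast
        then have "x \<in> A i"
          using elim(1) by (simp add: A_def)
        then show False
          using Z(2) elim(2) by blast
      qed
    qed
    then show False
      using prob_eq_0[OF E(1)] E(2) by simp
  qed
qed

end

section \<open>Dimensions of Markov measures\<close>

lemma hdim_nonneg: "0 \<le> hdim E"
  by (rule hdim_geI) simp

lemma pdim_nonneg: "0 \<le> pdim E"
  by (rule pdim_geI) simp

context cantor_prob_space
begin

lemma lower_hdim_leI: "\<exists>E\<in>sets M. prob E > 0 \<and> hdim E \<le> s \<Longrightarrow> lower_hdim M \<le> s"
  unfolding lower_hdim_def
  by (auto intro!: cInf_lower2[where x = "hdim _"] bdd_belowI[of _ 0] simp: hdim_nonneg)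

lemma lower_pdim_leI: "\<exists>E\<in>sets M. prob E > 0 \<and> pdim E \<le> s \<Longrightarrow> lower_pdim M \<le> s"
  unfolding lower_pdim_def
  by (auto intro!: cInf_lower2[where x = "pdim _"] bdd_belowI[of _ 0] simp: pdim_nonneg)

lemma exists_positive_event: "\<exists>E. E \<in> sets M \<and> prob E > 0"
  using sets.top[of M] prob_space by (intro exI[of _ "space M"]) auto

lemma lower_hdim_geI:
  assumes "\<And>E. E \<in> sets M \<Longrightarrow> prob E > 0 \<Longrightarrow> s \<le> hdim E"
  shows "s \<le> lower_hdim M"
  unfolding lower_hdim_def
proof (rule cInf_greatest)
  show "{hdim E |E. E \<in> sets M \<and> 0 < prob E} \<noteq> {}"
    using exists_positive_event by auto
qed (use assms in auto)

lemma lower_pdim_geI: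
  assumes "\<And>E. E \<in> sets M \<Longrightarrow> prob E > 0 \<Longrightarrow> s \<le> pdim E"
  shows "s \<le> lower_pdim M"
  unfolding lower_pdim_def
proof (rule cInf_greatest)
  show "{pdim E |E. E \<in> sets M \<and> 0 < prob E} \<noteq> {}"
    using exists_positive_event by auto
qed (use assms in auto)

end

text \<open>\<open>L\<close> is the lower limit, obtained as a real number from the supremum of the
  eventual lower bounds. Applied to the negated sequence it yields the upper limit.\<close>

lemma liminf_witness:
  fixes a :: "nat \<Rightarrow> real"
  assumes "\<And>n. l \<le> a n" "\<And>n. a n \<le> u"
  obtains L where "\<And>\<kappa>. \<kappa> > 0 \<Longrightarrow> \<forall>\<^sub>F n in sequentially. L - \<kappa> \<le> a n"
    "\<And>\<kappa>. \<kappa> > 0 \<Longrightarrow> \<exists>\<^sub>F n in sequentially. a n \<le> L + \<kappa>"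
proof -
  define S where "S = {b. \<forall>\<^sub>F n in sequentially. b \<le> a n}"
  have "l \<in> S"
    using assms(1) by (simp add: S_def)
  have "b \<le> u" if b: "b \<in> S" for b
  proof -
    obtain n where "b \<le> a n"
      using b by (auto simp: S_def eventually_sequentially)
    then show ?thesis
      using assms(2)[of n] by linarith
  qed
  then have bdd: "bdd_above S"
    by (rule bdd_aboveI)
  show ?thesis
  proof (rule that[of "Sup S"])
    fix \<kappa> :: real
    assume "\<kappa> > 0"
    then have "Sup S - \<kappa> < Sup S"
      by simp
    then obtain b where "b \<in> S" "Sup S - \<kappa> < b"
      using \<open>l \<in> S\<close> bdd by (subst (asm) less_cSup_iff) auto
    then show "\<forall>\<^sub>F n in sequentially. Sup S - \<kappa> \<le> a n"
      unfolding S_def by (auto elim: eventually_mono)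
    have "Sup S + \<kappa> \<notin> S"
      using cSup_upper[OF _ bdd, of "Sup S + \<kappa>"] \<open>\<kappa> > 0\<close> by auto
    then have "\<exists>\<^sub>F n in sequentially. \<not> Sup S + \<kappa> \<le> a n"
      by (simp add: S_def not_eventually)
    then show "\<exists>\<^sub>F n in sequentially. a n \<le> Sup S + \<kappa>"
      by (rule frequently_elim1) simp
  qed
qed

section \<open>Entropy rate and its relation to the two dimensions\<close>

context transition_kernel
begin

text \<open>At \<open>n = 0\<close> the quotient has the junk value \<open>0\<close>.\<close>
definition entropy_rate :: "nat \<Rightarrow> real" where
  "entropy_rate n = mean_sum step_entropy n 0 False / (n * ln 2)"

text \<open>The crude bound 1 on the entropy in nats gives \<open>1 / ln 2\<close> instead of 1; the
  upper bound serves to keep the limits of the rate finite.\<close>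

lemma entropy_rate_bounds: "0 \<le> entropy_rate n" "entropy_rate n \<le> 1 / ln 2"
proof -
  have "0 \<le> mean_sum step_entropy n 0 False \<and> mean_sum step_entropy n 0 False \<le> n"
  proof (induction n)
    case (Suc n)
    then show ?case
      using mean_sum_Suc_bounds[of step_entropy, OF step_entropy_bounds, of n 0 False]
      by (simp del: mean_sum.simps)
  qed simp
  then show "0 \<le> entropy_rate n" "entropy_rate n \<le> 1 / ln 2"
    by (cases "n = 0"; simp add: entropy_rate_def field_simps)+
qed

lemma AE_cyl_bounds:
  assumes M: "cantor_prob_space M" "\<And>w. measure M (cyl w) = path_weight 0 False w" and "\<kappa> > 0"
  shows "AE x in M. \<forall>\<^sub>F n in sequentially.
    2 powr (- (entropy_rate n + \<kappa>) * n) \<le> measure M (cyl (pref x n)) \<and>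
    measure M (cyl (pref x n)) \<le> 2 powr (- (entropy_rate n - \<kappa>) * n)"
proof -
  have "AE x in M. \<forall>\<^sub>F n in sequentially.
      \<bar>- ln (measure M (cyl (pref x n))) - mean_sum step_entropy n 0 False\<bar> \<le> (\<kappa> * ln 2) * n"
    using M \<open>\<kappa> > 0\<close> by (intro AE_information_close_to_entropy) auto
  with cantor_prob_space.AE_cyl_pref_pos[OF M(1)] show ?thesis
  proof eventually_elim
    case (elim x)
    from elim(2) show ?case
      using eventually_gt_at_top[of 0]
    proof eventually_elim
      case (elim n)
      let ?P = "measure M (cyl (pref x n))"
      have P: "?P = exp (ln ?P)"
        using \<open>\<forall>n. 0 < measure M (cyl (pref x n))\<close> by simp
      have H: "mean_sum step_entropy n 0 False = entropy_rate n * n * ln 2"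
        using elim(2) by (simp add: entropy_rate_def)
      have "- (entropy_rate n + \<kappa>) * n * ln 2 \<le> ln ?P" "ln ?P \<le> - (entropy_rate n - \<kappa>) * n * ln 2"
        using elim(1) unfolding H by (auto simp: abs_le_iff algebra_simps)
      then show ?case
        by (subst (1 2) P) (simp add: powr_def)
    qed
  qed
qed

text \<open>Light cylinders at all late generations bound \<open>hdim\<close> from below, and heavy
  ones at infinitely many generations bound it from above; hence the lower limit of the rate
  decides.\<close>

lemma lower_hdim_bounds:
  assumes M: "cantor_prob_space M" "\<And>w. measure M (cyl w) = path_weight 0 False w" and "\<kappa> > 0"
    and L: "\<forall>\<^sub>F n in sequentially. L \<le> entropy_rate n"
    and U: "\<exists>\<^sub>F n in sequentially. entropy_rate n \<le> U"
  shows "L - \<kappa> \<le> lower_hdim M" "lower_hdim M \<le> U + \<kappa>"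
proof -
  interpret M: cantor_prob_space M by fact
  note AE = AE_cyl_bounds[OF M \<open>\<kappa> > 0\<close>]
  show "L - \<kappa> \<le> lower_hdim M"
  proof (intro M.lower_hdim_geI M.hdim_lower_bound)
    show "AE x in M. \<forall>\<^sub>F n in sequentially. measure M (cyl (pref x n)) \<le> 2 powr (- (L - \<kappa>) * n)"
      using AE
    proof eventually_elim
      case (elim x)
      from elim L show ?case
      proof eventually_elim
        case (elim n)
        have "2 powr (- (entropy_rate n - \<kappa>) * n) \<le> 2 powr (- (L - \<kappa>) * n)"
          using elim by (intro powr_mono mult_right_mono) auto
        then show ?case
          using elim by linarith
      qed
    qed
  qed
  show "lower_hdim M \<le> U + \<kappa>"
  proof (intro M.lower_hdim_leI M.exists_small_hdim)
    obtain n where "entropy_rate n \<le> U"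
      using frequently_ex[OF U] by blast
    then show "0 \<le> U + \<kappa>"
      using entropy_rate_bounds(1)[of n] \<open>\<kappa> > 0\<close> by linarith
    show "AE x in M. \<exists>\<^sub>F n in sequentially. 2 powr (- (U + \<kappa>) * n) \<le> measure M (cyl (pref x n))"
      using AE
    proof eventually_elim
      case (elim x)
      from U elim have "\<exists>\<^sub>F n in sequentially. entropy_rate n \<le> U \<and>
          2 powr (- (entropy_rate n + \<kappa>) * n) \<le> measure M (cyl (pref x n)) \<and>
          measure M (cyl (pref x n)) \<le> 2 powr (- (entropy_rate n - \<kappa>) * n)"
        by (rule frequently_eventually_frequently)
      then show ?case
      proof (rule frequently_elim1)
        fix n
        assume *: "entropy_rate n \<le> U \<and>
          2 powr (- (entropy_rate n + \<kappa>) * n) \<le> measure M (cyl (pref x n)) \<and>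
          measure M (cyl (pref x n)) \<le> 2 powr (- (entropy_rate n - \<kappa>) * n)"
        then have "2 powr (- (U + \<kappa>) * n) \<le> 2 powr (- (entropy_rate n + \<kappa>) * n)"
          by (intro powr_mono mult_right_mono) auto
        then show "2 powr (- (U + \<kappa>) * n) \<le> measure M (cyl (pref x n))"
          using * by linarith
      qed
    qed
  qed
qed

text \<open>For packing dimension, "eventually" and "infinitely often" change places, so the upper
  limit of the rate decides.\<close>

lemma lower_pdim_bounds:
  assumes M: "cantor_prob_space M" "\<And>w. measure M (cyl w) = path_weight 0 False w" and "\<kappa> > 0"
    and L: "\<exists>\<^sub>F n in sequentially. L \<le> entropy_rate n"
    and U: "\<forall>\<^sub>F n in sequentially. entropy_rate n \<le> U"
  shows "L - \<kappa> \<le> lower_pdim M" "lower_pdim M \<le> U + \<kappa>"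
proof -
  interpret M: cantor_prob_space M by fact
  note AE = AE_cyl_bounds[OF M \<open>\<kappa> > 0\<close>]
  show "L - \<kappa> \<le> lower_pdim M"
  proof (intro M.lower_pdim_geI M.pdim_lower_bound)
    show "AE x in M. \<exists>\<^sub>F n in sequentially. measure M (cyl (pref x n)) \<le> 2 powr (- (L - \<kappa>) * n)"
      using AE
    proof eventually_elim
      case (elim x)
      from L elim have "\<exists>\<^sub>F n in sequentially. L \<le> entropy_rate n \<and>
          2 powr (- (entropy_rate n + \<kappa>) * n) \<le> measure M (cyl (pref x n)) \<and>
          measure M (cyl (pref x n)) \<le> 2 powr (- (entropy_rate n - \<kappa>) * n)"
        by (rule frequently_eventually_frequently)
      then show ?case
      proof (rule frequently_elim1)
        fix n
        assume *: "L \<le> entropy_rate n \<and>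
          2 powr (- (entropy_rate n + \<kappa>) * n) \<le> measure M (cyl (pref x n)) \<and>
          measure M (cyl (pref x n)) \<le> 2 powr (- (entropy_rate n - \<kappa>) * n)"
        then have "2 powr (- (entropy_rate n - \<kappa>) * n) \<le> 2 powr (- (L - \<kappa>) * n)"
          by (intro powr_mono mult_right_mono) auto
        then show "measure M (cyl (pref x n)) \<le> 2 powr (- (L - \<kappa>) * n)"
          using * by linarith
      qed
    qed
  qed
  show "lower_pdim M \<le> U + \<kappa>"
  proof (intro M.lower_pdim_leI M.exists_small_pdim)
    obtain n where "entropy_rate n \<le> U"
      using U by (auto simp: eventually_sequentially)
    then show "0 \<le> U + \<kappa>"
      using entropy_rate_bounds(1)[of n] \<open>\<kappa> > 0\<close> by linarith
    show "AE x in M. \<forall>\<^sub>F n in sequentially. 2 powr (- (U + \<kappa>) * n) \<le> measure M (cyl (pref x n))"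
      using AE
    proof eventually_elim
      case (elim x)
      from elim U show ?case
      proof eventually_elim
        case (elim n)
        have "2 powr (- (U + \<kappa>) * n) \<le> 2 powr (- (entropy_rate n + \<kappa>) * n)"
          using elim by (intro powr_mono mult_right_mono) auto
        then show ?case
          using elim by linarith
      qed
    qed
  qed
qed

end

text \<open>Clipping both chains with the same \<open>B\<close> leaves an error linear in the
  horizon, and dividing by \<open>n\<close> makes it uniform in \<open>n\<close>.\<close>

lemma entropy_rate_uniformly_continuous:
  assumes "\<kappa> > 0"
  obtains \<zeta> where "\<zeta> > 0"
    "\<And>t t' n. transition_kernel t \<Longrightarrow> transition_kernel t' \<Longrightarrow>
      (\<And>k a. \<bar>t k a False - t' k a False\<bar> < \<zeta>) \<Longrightarrow>
      \<bar>transition_kernel.entropy_rate t n - transition_kernel.entropy_rate t' n\<bar> \<le> \<kappa>"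
proof -
  define \<theta> where "\<theta> = \<kappa> * ln 2 / 4"
  have \<theta>: "\<theta> > 0"
    using assms by (simp add: \<theta>_def)
  obtain B where B: "B \<ge> 0" "\<And>x. x \<in> {0..1} \<Longrightarrow> binary_entropy x \<le> B * min x (1 - x) + \<theta>"
    using binary_entropy_le_linear[OF \<theta>] by blast
  obtain \<delta> where \<delta>: "\<delta> > 0" "\<And>x y. x \<in> {0..1} \<Longrightarrow> y \<in> {0..1} \<Longrightarrow> \<bar>x - y\<bar> < \<delta> \<Longrightarrow>
      \<bar>binary_entropy x - binary_entropy y\<bar> \<le> \<theta>"
    using binary_entropy_uniform_modulus[OF \<theta>] by blast
  define \<zeta> where "\<zeta> = min \<delta> (\<theta> / (3 * B + 1))"
  have \<zeta>: "0 < \<zeta>" "\<zeta> \<le> \<delta>" "3 * B * \<zeta> \<le> \<theta>"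
  proof -
    show "0 < \<zeta>" "\<zeta> \<le> \<delta>"
      using \<delta> \<theta> B by (auto simp: \<zeta>_def)
    have "(3 * B + 1) * \<zeta> \<le> (3 * B + 1) * (\<theta> / (3 * B + 1))"
      using B by (intro mult_left_mono) (auto simp: \<zeta>_def)
    also have "\<dots> = \<theta>"
      using B by simp
    finally show "3 * B * \<zeta> \<le> \<theta>"
      using \<open>0 < \<zeta>\<close> by (simp add: algebra_simps)
  qed
  show ?thesis
  proof (rule that[OF \<zeta>(1)])
    fix t t' :: "nat \<Rightarrow> bool \<Rightarrow> bool \<Rightarrow> real" and n :: nat
    assume t: "transition_kernel t" and t': "transition_kernel t'"
      and close: "\<And>k a. \<bar>t k a False - t' k a False\<bar> < \<zeta>"
    interpret A: transition_kernel t by fact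
    interpret A': transition_kernel t' by fact
    let ?H = "A.mean_sum A.step_entropy n 0 False" and ?H' = "A'.mean_sum A'.step_entropy n 0 False"
    let ?F = "A.mean_sum (A.clipped_entropy B) n 0 False"
    let ?F' = "A'.mean_sum (A'.clipped_entropy B) n 0 False"
    have "?F \<le> ?H" "?H \<le> ?F + \<theta> * n"
      using A.mean_sum_mono[of "A.clipped_entropy B" A.step_entropy 0 n 0 False]
        A.mean_sum_mono[of A.step_entropy "A.clipped_entropy B" \<theta> n 0 False]
        A.clipped_entropy_bounds[OF B] by auto
    moreover have "?F' \<le> ?H'" "?H' \<le> ?F' + \<theta> * n"
      using A'.mean_sum_mono[of "A'.clipped_entropy B" A'.step_entropy 0 n 0 False]
        A'.mean_sum_mono[of A'.step_entropy "A'.clipped_entropy B" \<theta> n 0 False]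
        A'.clipped_entropy_bounds[OF B] by auto
    moreover have "\<bar>?F - ?F'\<bar> \<le> (\<theta> + 3 * B * \<zeta>) * n"
    proof (rule mean_clipped_entropy_diff[OF t t' B(1)])
      show "\<bar>t k a False - t' k a False\<bar> \<le> \<zeta>" for k a
        using close by (simp add: less_imp_le)
      show "\<bar>binary_entropy (t k a False) - binary_entropy (t' k a False)\<bar> \<le> \<theta>" for k a
        using close[of k a] \<zeta>(2) A.t_range A'.t_range by (intro \<delta>(2)) auto
    qed
    moreover have "(\<theta> + 3 * B * \<zeta>) * n \<le> (2 * \<theta>) * n"
      using \<zeta>(3) by (intro mult_right_mono) auto
    ultimately have "\<bar>?H - ?H'\<bar> \<le> 4 * \<theta> * n"
      by (simp add: algebra_simps)
    then have HH: "\<bar>?H - ?H'\<bar> \<le> \<kappa> * (n * ln 2)"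
      by (simp add: \<theta>_def algebra_simps)
    have "\<bar>A.entropy_rate n - A'.entropy_rate n\<bar> = \<bar>?H - ?H'\<bar> / (n * ln 2)"
      by (simp add: A.entropy_rate_def A'.entropy_rate_def diff_divide_distrib[symmetric])
    also have "\<dots> \<le> \<kappa>"
      using HH assms by (cases "n = 0") (auto simp: pos_divide_le_eq)
    finally show "\<bar>A.entropy_rate n - A'.entropy_rate n\<bar> \<le> \<kappa>" .
  qed
qed

lemma transition_kernel_trans_prob:
  assumes "\<And>n. p n \<in> {0..1}" "\<And>n. q n \<in> {0..1}"
  shows "transition_kernel (trans_prob p q)"
  using assms by unfold_locales (auto simp: trans_prob_def)

text \<open>The initial law is the transition from state \<open>False\<close> at time \<open>0\<close>.\<close>
lemma markov_cyl_eq_path_weight: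
  assumes "transition_kernel (trans_prob p q)"
  shows "markov_cyl p q w = transition_kernel.path_weight (trans_prob p q) 0 False w"
proof -
  interpret transition_kernel "trans_prob p q" by fact
  have prod: "path_weight k a w = (\<Prod>i<length w. trans_prob p q (k + i) ((a # w) ! i) (w ! i))"
    for k a w
  proof (induction w arbitrary: k a)
    case (Cons b w)
    then show ?case
      by (simp add: prod.lessThan_Suc_shift del: prod.lessThan_Suc)
  qed simp
  show ?thesis
  proof (cases w)
    case (Cons b v)
    have "(\<Prod>k\<in>{1..<length w}. trans_prob p q k (w ! (k - 1)) (w ! k)) =
        (\<Prod>i<length v. trans_prob p q (Suc i) (w ! i) (w ! Suc i))"
      by (rule prod.reindex_bij_witness[of _ Suc "\<lambda>k. k - 1"]) (auto simp: Cons)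
    moreover have "path_weight (Suc 0) b v =
        (\<Prod>i<length v. trans_prob p q (Suc i) (w ! i) (w ! Suc i))"
      by (simp add: prod Cons)
    ultimately show ?thesis
      by (simp add: Cons markov_cyl_def trans_prob_def)
  qed (simp add: markov_cyl_def)
qed

theorem theorem2:
  fixes \<epsilon> :: real
  assumes "\<epsilon> > 0"
  shows "\<exists>\<zeta>>0. \<forall>(p::nat \<Rightarrow> real) (q::nat \<Rightarrow> real) (p'::nat \<Rightarrow> real) (q'::nat \<Rightarrow> real)
            (M::(nat \<Rightarrow> bool) measure) (M'::(nat \<Rightarrow> bool) measure).
     (\<forall>n. p n \<in> {0..1} \<and> q n \<in> {0..1} \<and> p' n \<in> {0..1} \<and> q' n \<in> {0..1}) \<and>
     (SUP n. max \<bar>p n - p' n\<bar> \<bar>q n - q' n\<bar>) < \<zeta> \<and>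
     markov_measure p q M \<and> markov_measure p' q' M'
     \<longrightarrow> \<bar>lower_hdim M - lower_hdim M'\<bar> < \<epsilon> \<and> \<bar>lower_pdim M - lower_pdim M'\<bar> < \<epsilon>"
proof -
  define \<kappa> where "\<kappa> = \<epsilon> / 6"
  have \<kappa>: "\<kappa> > 0"
    using assms by (simp add: \<kappa>_def)
  obtain \<zeta> where \<zeta>: "\<zeta> > 0" "\<And>t t' n. transition_kernel t \<Longrightarrow> transition_kernel t' \<Longrightarrow>
      (\<And>k a. \<bar>t k a False - t' k a False\<bar> < \<zeta>) \<Longrightarrow>
      \<bar>transition_kernel.entropy_rate t n - transition_kernel.entropy_rate t' n\<bar> \<le> \<kappa>"
    using entropy_rate_uniformly_continuous[OF \<kappa>] by metis
  have "\<bar>lower_hdim M - lower_hdim M'\<bar> < \<epsilon> \<and> \<bar>lower_pdim M - lower_pdim M'\<bar> < \<epsilon>"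
    if range: "\<And>n. p n \<in> {0..1} \<and> q n \<in> {0..1} \<and> p' n \<in> {0..1} \<and> q' n \<in> {0..1}"
      and sup: "(SUP n. max \<bar>p n - p' n\<bar> \<bar>q n - q' n\<bar>) < \<zeta>"
      and mM: "markov_measure p q M" and mM': "markov_measure p' q' M'"
    for p q p' q' :: "nat \<Rightarrow> real" and M M' :: "(nat \<Rightarrow> bool) measure"
  proof -
    interpret A: transition_kernel "trans_prob p q"
      using range by (intro transition_kernel_trans_prob) auto
    interpret A': transition_kernel "trans_prob p' q'"
      using range by (intro transition_kernel_trans_prob) auto
    have M: "cantor_prob_space M" "\<And>w. measure M (cyl w) = A.path_weight 0 False w"
      using mM markov_cyl_eq_path_weight[OF A.transition_kernel_axioms]
      by (auto simp: markov_measure_def cantor_prob_space_def cantor_prob_space_axioms_def)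
    have M': "cantor_prob_space M'" "\<And>w. measure M' (cyl w) = A'.path_weight 0 False w"
      using mM' markov_cyl_eq_path_weight[OF A'.transition_kernel_axioms]
      by (auto simp: markov_measure_def cantor_prob_space_def cantor_prob_space_axioms_def)
    have "\<bar>p n - p' n\<bar> < \<zeta> \<and> \<bar>q n - q' n\<bar> < \<zeta>" for n
    proof -
      have "max \<bar>p n - p' n\<bar> \<bar>q n - q' n\<bar> \<le> 1" for n
        using range[of n] by auto
      then have "bdd_above (range (\<lambda>n. max \<bar>p n - p' n\<bar> \<bar>q n - q' n\<bar>))"
        by (rule bdd_aboveI2)
      then have "max \<bar>p n - p' n\<bar> \<bar>q n - q' n\<bar> \<le> (SUP n. max \<bar>p n - p' n\<bar> \<bar>q n - q' n\<bar>)"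
        by (intro cSUP_upper) auto
      then show ?thesis
        using sup by auto
    qed
    then have "\<bar>trans_prob p q k a False - trans_prob p' q' k a False\<bar> < \<zeta>" for k a
      by (auto simp: trans_prob_def)
    then have close: "\<bar>A.entropy_rate n - A'.entropy_rate n\<bar> \<le> \<kappa>" for n
      by (intro \<zeta>(2) A.transition_kernel_axioms A'.transition_kernel_axioms)
    have shift: "c \<le> A.entropy_rate n \<Longrightarrow> c - \<kappa> \<le> A'.entropy_rate n"
      "A.entropy_rate n \<le> c \<Longrightarrow> A'.entropy_rate n \<le> c + \<kappa>" for n c
      using close[of n] by linarith+
    obtain L where L: "\<forall>\<^sub>F n in sequentially. L - \<kappa> \<le> A.entropy_rate n"
      "\<exists>\<^sub>F n in sequentially. A.entropy_rate n \<le> L + \<kappa>"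
      using liminf_witness[of 0 A.entropy_rate "1 / ln 2"] A.entropy_rate_bounds \<kappa> by metis
    have L1': "\<forall>\<^sub>F n in sequentially. L - \<kappa> - \<kappa> \<le> A'.entropy_rate n"
      using L(1) shift(1) by (rule eventually_mono)
    have L2': "\<exists>\<^sub>F n in sequentially. A'.entropy_rate n \<le> L + \<kappa> + \<kappa>"
      using L(2) shift(2) by (rule frequently_elim1)
    obtain U where U: "\<forall>\<^sub>F n in sequentially. U - \<kappa> \<le> - A.entropy_rate n"
      "\<exists>\<^sub>F n in sequentially. - A.entropy_rate n \<le> U + \<kappa>"
      using liminf_witness[of "- (1 / ln 2)" "\<lambda>n. - A.entropy_rate n" 0] A.entropy_rate_bounds \<kappa>
      by (metis neg_le_0_iff_le neg_le_iff_le)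
    have U1: "\<forall>\<^sub>F n in sequentially. A.entropy_rate n \<le> \<kappa> - U"
      using U(1) by (rule eventually_mono) simp
    have U2: "\<exists>\<^sub>F n in sequentially. - U - \<kappa> \<le> A.entropy_rate n"
      using U(2) by (rule frequently_elim1) simp
    have U1': "\<forall>\<^sub>F n in sequentially. A'.entropy_rate n \<le> \<kappa> - U + \<kappa>"
      using U1 shift(2) by (rule eventually_mono)
    have U2': "\<exists>\<^sub>F n in sequentially. - U - \<kappa> - \<kappa> \<le> A'.entropy_rate n"
      using U2 shift(1) by (rule frequently_elim1)
    have "\<bar>lower_hdim M - lower_hdim M'\<bar> \<le> 5 * \<kappa>"
      using A.lower_hdim_bounds[OF M \<kappa> L] A'.lower_hdim_bounds[OF M' \<kappa> L1' L2'] by linarith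
    moreover have "\<bar>lower_pdim M - lower_pdim M'\<bar> \<le> 5 * \<kappa>"
      using A.lower_pdim_bounds[OF M \<kappa> U2 U1] A'.lower_pdim_bounds[OF M' \<kappa> U2' U1'] by linarith
    ultimately show ?thesis
      using assms by (simp add: \<kappa>_def)
  qed
  with \<zeta>(1) show ?thesis
    by blast
qed

end
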